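(* Let $\mathbb{P}_{\mathsf{aux}}$ be the transition kernel of the TunaMH algorithm with proposal $q$, hyperparameter $\chi>0$, positive constants $c_1,\dots,c_N$ and symmetric non-negative function $M$, and let $\mathbb{P}_{\mathsf{ideal}}$ be the transition kernel of the standard Metropolis–Hastings algorithm with the same proposal $q$ and the same target $\pi(\theta\mid x)$. Then $$\mathsf{Gap}(\mathbb{P}_{\mathsf{aux}})\ \ge\ e^{-1/e}\exp\left\{-\frac{1}{2\chi}\right\}\,\mathsf{Gap}(\mathbb{P}_{\mathsf{ideal}}).$$
   Context: Setting. $\Theta$ is a measurable space with a base measure; the target is the probability distribution $\Pi$ on $\Theta$ with density $\pi(\theta\mid x)\propto\exp\{-\sum_{i=1}^N U_i(\theta;x)\}$ ($x$ is fixed data), where for all $\theta,\theta'$ and each $i$, $|U_i(\theta';x)-U_i(\theta;x)|\le c_i M(\theta,\theta')$ for a symmetric non-negative function $M$ on $\Theta\times\Theta$ and positive constants $c_i$. Put $C=\sum_{i=1}^N c_i$. $q(\theta,\cdot)$ is the density (w.r.t. the base measure) of a Markov proposal kernel on $\Theta$. TunaMH. From current state $\theta$: propose $\theta'\sim q(\theta,\cdot)$; set $\lambda=\chi C^2M^2(\theta,\theta')$ and $\phi_i(\theta,\theta';x)=\frac{U_i(\theta';x)-U_i(\theta;x)}{2}+\frac{c_i}{2}M(\theta,\theta')$; sample, independently over $i=1,\dots,N$, $s_i\sim\mathrm{Poisson}\bigl(\frac{\lambda c_i}{C}+\phi_i(\theta,\theta';x)\bigr)$; let $S=\{i:s_i>0\}$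 and $$r=\frac{\exp\{\sum_{i\in S}s_i\log(1+\frac{C}{\lambda c_i}\phi_i(\theta',\theta;x))\}}{\exp\{\sum_{i\in S}s_i\log(1+\frac{C}{\lambda c_i}\phi_i(\theta,\theta';x))\}}\cdot\frac{q(\theta',\theta)}{q(\theta,\theta')};$$ with probability $\min\{1,r\}$ move to $\theta'$, otherwise stay at $\theta$. (If $M(\theta,\theta')=0$, then all Poisson parameters are $0$, $S=\emptyset$, and the sums over $S$ are $0$.) Idealized chain $\mathbb{P}_{\mathsf{ideal}}$. From $\theta$: propose $\theta'\sim q(\theta,\cdot)$ and accept with probability $\min\bigl\{1,\frac{\pi(\theta'\mid x)q(\theta',\theta)}{\pi(\theta\mid x)q(\theta,\theta')}\bigr\}$, otherwise stay. Both chains are reversible with respect to $\Pi$. Spectral gap. For a Markov kernel $P$ with stationary distribution $\Pi$, $L^2_0(\Pi)=\{f:\int f^2\,d\Pi<\infty,\ \int f\,d\Pi=0\}$ with norm $\lVert f\rVert_\Pi=(\int f^2 d\Pi)^{1/2}$, $(Pf)(\theta)=\int P(\theta,d\theta')f(\theta')$, $\lVert P\rVert_{L^2_0(\Pi)}=\sup\{\lVert Pf\rVert_\Pi: f\in L^2_0(\Pi),\lVert f\rVert_\Pi=1\}$, and $\mathsf{Gap}(P):=1-\lVert P\rVert_{L^2_0(\Pi)}$. *)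

theory Defs
  imports "HOL-Probability.Probability"
begin

definition target_density :: "'a measure \<Rightarrow> (nat \<Rightarrow> 'a \<Rightarrow> real) \<Rightarrow> nat \<Rightarrow> 'a \<Rightarrow> real" where
  "target_density \<nu> U N \<theta> =
     exp (- (\<Sum>i=1..N. U i \<theta>)) / (\<integral>\<eta>. exp (- (\<Sum>i=1..N. U i \<eta>)) \<partial>\<nu>)"

definition target :: "'a measure \<Rightarrow> (nat \<Rightarrow> 'a \<Rightarrow> real) \<Rightarrow> nat \<Rightarrow> 'a measure" where
  "target \<nu> U N = density \<nu> (\<lambda>\<theta>. ennreal (target_density \<nu> U N \<theta>))"

text \<open>
  One step of a propose/accept chain from \<open>\<theta>\<close>: draw \<open>\<theta>'\<close> with \<open>\<nu>\<close>-density \<open>q \<theta>\<close>, flip the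
  (possibly randomised) decision \<open>acc \<theta> \<theta>'\<close>, and move to \<open>\<theta>'\<close> if it is true, else stay.
\<close>

definition propose_accept_kernel ::
    "'a measure \<Rightarrow> ('a \<Rightarrow> 'a \<Rightarrow> real) \<Rightarrow> ('a \<Rightarrow> 'a \<Rightarrow> bool pmf) \<Rightarrow> 'a \<Rightarrow> 'a measure" where
  "propose_accept_kernel \<nu> q acc \<theta> =
     density \<nu> (\<lambda>\<theta>'. ennreal (q \<theta> \<theta>')) \<bind>
       (\<lambda>\<theta>'. distr (measure_pmf (acc \<theta> \<theta>')) \<nu> (\<lambda>b. if b then \<theta>' else \<theta>))"

text \<open>
  Where \<open>q \<theta> \<theta>' = 0\<close> the acceptance ratios below are 0 because division is total; such \<open>\<theta>'\<close> are
  proposed with probability 0.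
\<close>

definition ideal_accept ::
    "'a measure \<Rightarrow> (nat \<Rightarrow> 'a \<Rightarrow> real) \<Rightarrow> nat \<Rightarrow> ('a \<Rightarrow> 'a \<Rightarrow> real) \<Rightarrow> 'a \<Rightarrow> 'a \<Rightarrow> bool pmf" where
  "ideal_accept \<nu> U N q \<theta> \<theta>' =
     bernoulli_pmf (min 1 ((target_density \<nu> U N \<theta>' * q \<theta>' \<theta>) / (target_density \<nu> U N \<theta> * q \<theta> \<theta>')))"

definition P_ideal ::
    "'a measure \<Rightarrow> (nat \<Rightarrow> 'a \<Rightarrow> real) \<Rightarrow> nat \<Rightarrow> ('a \<Rightarrow> 'a \<Rightarrow> real) \<Rightarrow> 'a \<Rightarrow> 'a measure" where
  "P_ideal \<nu> U N q = propose_accept_kernel \<nu> q (ideal_accept \<nu> U N q)"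

text \<open>The library's \<^const>\<open>poisson_pmf\<close> is only specified for positive rates.\<close>

definition poisson0_pmf :: "real \<Rightarrow> nat pmf" where
  "poisson0_pmf r = (if r = 0 then return_pmf 0 else poisson_pmf r)"

definition tuna_phi ::
    "(nat \<Rightarrow> 'a \<Rightarrow> real) \<Rightarrow> (nat \<Rightarrow> real) \<Rightarrow> ('a \<Rightarrow> 'a \<Rightarrow> real) \<Rightarrow> nat \<Rightarrow> 'a \<Rightarrow> 'a \<Rightarrow> real" where
  "tuna_phi U c M i \<theta> \<theta>' = (U i \<theta>' - U i \<theta>) / 2 + c i / 2 * M \<theta> \<theta>'"

definition tuna_lambda ::
    "(nat \<Rightarrow> real) \<Rightarrow> ('a \<Rightarrow> 'a \<Rightarrow> real) \<Rightarrow> nat \<Rightarrow> real \<Rightarrow> 'a \<Rightarrow> 'a \<Rightarrow> real" where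
  "tuna_lambda c M N chi \<theta> \<theta>' = chi * (\<Sum>i=1..N. c i)\<^sup>2 * (M \<theta> \<theta>')\<^sup>2"

definition tuna_samples ::
    "(nat \<Rightarrow> 'a \<Rightarrow> real) \<Rightarrow> (nat \<Rightarrow> real) \<Rightarrow> ('a \<Rightarrow> 'a \<Rightarrow> real) \<Rightarrow> nat \<Rightarrow> real \<Rightarrow> 'a \<Rightarrow> 'a \<Rightarrow> (nat \<Rightarrow> nat) pmf" where
  "tuna_samples U c M N chi \<theta> \<theta>' =
     Pi_pmf {1..N} 0 (\<lambda>i. poisson0_pmf
       (tuna_lambda c M N chi \<theta> \<theta>' * c i / (\<Sum>j=1..N. c j) + tuna_phi U c M i \<theta> \<theta>'))"

definition tuna_ratio ::
    "(nat \<Rightarrow> 'a \<Rightarrow> real) \<Rightarrow> (nat \<Rightarrow> real) \<Rightarrow> ('a \<Rightarrow> 'a \<Rightarrow> real) \<Rightarrow> nat \<Rightarrow> real \<Rightarrow>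
     ('a \<Rightarrow> 'a \<Rightarrow> real) \<Rightarrow> 'a \<Rightarrow> 'a \<Rightarrow> (nat \<Rightarrow> nat) \<Rightarrow> real" where
  "tuna_ratio U c M N chi q \<theta> \<theta>' s =
     (let C = (\<Sum>i=1..N. c i); L = tuna_lambda c M N chi \<theta> \<theta>'; S = {i\<in>{1..N}. s i > 0} in
        exp (\<Sum>i\<in>S. real (s i) * ln (1 + C / (L * c i) * tuna_phi U c M i \<theta>' \<theta>)) /
        exp (\<Sum>i\<in>S. real (s i) * ln (1 + C / (L * c i) * tuna_phi U c M i \<theta> \<theta>')) *
        (q \<theta>' \<theta> / q \<theta> \<theta>'))"

definition tuna_accept ::
    "(nat \<Rightarrow> 'a \<Rightarrow> real) \<Rightarrow> (nat \<Rightarrow> real) \<Rightarrow> ('a \<Rightarrow> 'a \<Rightarrow> real) \<Rightarrow> nat \<Rightarrow> real \<Rightarrow>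
     ('a \<Rightarrow> 'a \<Rightarrow> real) \<Rightarrow> 'a \<Rightarrow> 'a \<Rightarrow> bool pmf" where
  "tuna_accept U c M N chi q \<theta> \<theta>' =
     bind_pmf (tuna_samples U c M N chi \<theta> \<theta>')
       (\<lambda>s. bernoulli_pmf (min 1 (tuna_ratio U c M N chi q \<theta> \<theta>' s)))"

definition P_aux ::
    "'a measure \<Rightarrow> (nat \<Rightarrow> 'a \<Rightarrow> real) \<Rightarrow> (nat \<Rightarrow> real) \<Rightarrow> ('a \<Rightarrow> 'a \<Rightarrow> real) \<Rightarrow> nat \<Rightarrow> real \<Rightarrow>
     ('a \<Rightarrow> 'a \<Rightarrow> real) \<Rightarrow> 'a \<Rightarrow> 'a measure" where
  "P_aux \<nu> U c M N chi q = propose_accept_kernel \<nu> q (tuna_accept U c M N chi q)"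

definition L2_norm :: "'a measure \<Rightarrow> ('a \<Rightarrow> real) \<Rightarrow> real" where
  "L2_norm \<mu> f = sqrt (\<integral>\<theta>. (f \<theta>)\<^sup>2 \<partial>\<mu>)"

definition L20 :: "'a measure \<Rightarrow> ('a \<Rightarrow> real) set" where
  "L20 \<mu> = {f \<in> borel_measurable \<mu>. integrable \<mu> (\<lambda>\<theta>. (f \<theta>)\<^sup>2) \<and> (\<integral>\<theta>. f \<theta> \<partial>\<mu>) = 0}"

definition kernel_op :: "('a \<Rightarrow> 'a measure) \<Rightarrow> ('a \<Rightarrow> real) \<Rightarrow> 'a \<Rightarrow> real" where
  "kernel_op P f \<theta> = (\<integral>\<theta>'. f \<theta>' \<partial>P \<theta>)"

text \<open>
  The supremum is taken in \<^typ>\<open>ennreal\<close>, where it always exists; it is 0 if \<open>L20 \<mu>\<close> contains no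
  function of norm 1.  If \<open>\<mu>\<close> is stationary for \<open>P\<close>, then \<open>kernel_op P f\<close> is square integrable for
  every \<open>f\<close> in \<open>L20 \<mu>\<close>, so that its real-valued norm is the proper one.
\<close>

definition op_norm_L20 :: "'a measure \<Rightarrow> ('a \<Rightarrow> 'a measure) \<Rightarrow> ennreal" where
  "op_norm_L20 \<mu> P = (SUP f \<in> {f \<in> L20 \<mu>. L2_norm \<mu> f = 1}. ennreal (L2_norm \<mu> (kernel_op P f)))"

definition Gap :: "'a measure \<Rightarrow> ('a \<Rightarrow> 'a measure) \<Rightarrow> ereal" where
  "Gap \<mu> P = 1 - enn2ereal (op_norm_L20 \<mu> P)"

end

theory Submission
  imports Defs
begin

text \<open>
  Let \<open>a\<close> and \<open>\<alpha>\<close> be the acceptance probabilities of TunaMH and of the ideal chain, and let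
  \<open>\<kappa> = exp (- 1 / e) * exp (- 1 / (2 \<chi>))\<close>. If \<open>\<kappa> \<alpha> \<le> a \<le> \<alpha>\<close>, then the off-diagonal part
  \<open>q (a - \<kappa> \<alpha>)\<close> of \<open>P_aux - \<kappa> P_ideal\<close> is nonnegative of mass at most \<open>1 - \<kappa>\<close>, so
  \<open>P_aux = \<kappa> P_ideal + (1 - \<kappa>) K\<close> with a reversible Markov kernel \<open>K\<close>. Since \<open>K\<close> is a
  contraction, the triangle inequality for the operator norm yields the bound on the gaps.

  The TunaMH ratio is \<open>\<rho> R(s)\<close>, where \<open>\<rho>\<close> is the Metropolis-Hastings ratio and \<open>R\<close> is the likelihood
  ratio of the product Poisson laws for \<open>(\<theta>', \<theta>)\<close> and \<open>(\<theta>, \<theta>')\<close>. As \<open>R\<close> has mean 1, \<open>a \<le> \<alpha>\<close>.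
  Conversely \<open>a \<ge> \<alpha> E (min 1 R)\<close>, and by Jensen's inequality and \<open>max 0 (ln R) \<le> R / e\<close> this expectation
  is at least \<open>exp (- D - 1 / e)\<close>, where the relative entropy \<open>D\<close> of the two laws is at most
  \<open>1 / (2 \<chi>)\<close> because every Poisson rate is at least \<open>\<lambda> c i / C\<close>.
\<close>

section \<open>Sigma-finiteness, weighted integrability and the triangle inequality in L2\<close>

text \<open>The density \<open>g\<close> makes \<open>M\<close> a finite measure, and reweighting
  that by \<open>1 / g\<close> gives \<open>M\<close> back. Applied to the unnormalised target
  density, this makes the base measure sigma-finite, as Tonelli requires later.\<close>

lemma sigma_finite_measure_of_pos_integrable:
  fixes g :: "'a \<Rightarrow> real"
  assumes g: "integrable M g" and pos: "\<And>x. x \<in> space M \<Longrightarrow> g x > 0"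
  shows "sigma_finite_measure M"
proof -
  have [measurable]: "g \<in> borel_measurable M"
    using g by simp
  define D where "D = density M (\<lambda>x. ennreal (g x))"
  have "emeasure D (space D) = ennreal (integral\<^sup>L M g)"
    using g pos by (auto simp: D_def emeasure_density less_imp_le nn_integral_eq_integral[symmetric]
      intro!: nn_integral_cong)
  then interpret D: finite_measure D
    by (intro finite_measureI) auto
  have "sigma_finite_measure (density D (\<lambda>x. ennreal (1 / g x)))"
    by (subst D.sigma_finite_iff_density_finite) (auto simp: D_def)
  also have "density D (\<lambda>x. ennreal (1 / g x)) = density M (\<lambda>x. ennreal (g x) * ennreal (1 / g x))"
    unfolding D_def by (rule density_density_eq) auto
  also have "\<dots> = density M (\<lambda>_. 1)"
    by (intro density_cong AE_I2) (use pos in \<open>auto simp: ennreal_mult''[symmetric] less_imp_le less_imp_neq[THEN not_sym]\<close>)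
  finally show ?thesis
    by (simp add: density_1)
qed

text \<open>Since \<open>\<bar>f x\<bar>\<close> is at most 1 plus the square of \<open>f x\<close>,
  the product is dominated by \<open>h\<close> plus \<open>h\<close> times the square of
  \<open>f\<close>. It will be applied to a jump density \<open>h\<close> with fixed starting
  point.\<close>

lemma integrable_mult_of_nonneg_squares:
  fixes h f :: "'a \<Rightarrow> real"
  assumes [measurable]: "f \<in> borel_measurable M"
    and h: "integrable M h" "\<And>x. x \<in> space M \<Longrightarrow> 0 \<le> h x"
    and hf: "integrable M (\<lambda>x. h x * (f x)\<^sup>2)"
  shows "integrable M (\<lambda>x. h x * f x)"
proof (rule Bochner_Integration.integrable_bound)
  show "integrable M (\<lambda>x. h x + h x * (f x)\<^sup>2)"
    using h hf by simp
  have "\<bar>h x * f x\<bar> \<le> \<bar>h x + h x * (f x)\<^sup>2\<bar>" if "x \<in> space M" for x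
  proof -
    have "\<bar>f x\<bar> \<le> 1 + (f x)\<^sup>2"
      \<comment> \<open>Expanding the square gives the sharper bound with 1 / 4 in place of
        1.\<close>
      using zero_le_power2[of "\<bar>f x\<bar> - 1 / 2"] by (simp add: power2_eq_square algebra_simps)
    then have "h x * \<bar>f x\<bar> \<le> h x * (1 + (f x)\<^sup>2)"
      using h(2)[OF that] by (rule mult_left_mono)
    then show ?thesis
      using h(2)[OF that] by (simp add: abs_mult algebra_simps)
  qed
  then show "AE x in M. norm (h x * f x) \<le> norm (h x + h x * (f x)\<^sup>2)"
    by auto
qed (use h in measurable)

text \<open>Minkowski's inequality from a weighted form of convexity of the square: with weights
  built from the two norms, the integrated bound is exactly the square of their sum.\<close>

lemma L2_norm_add_le:
  fixes f g :: "'a \<Rightarrow> real"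
  assumes [measurable]: "f \<in> borel_measurable M" "g \<in> borel_measurable M"
    and f: "integrable M (\<lambda>x. (f x)\<^sup>2)" and g: "integrable M (\<lambda>x. (g x)\<^sup>2)"
  shows "L2_norm M (\<lambda>x. f x + g x) \<le> L2_norm M f + L2_norm M g"
proof (rule field_le_epsilon)
  fix e :: real
  assume e: "0 < e"
  \<comment> \<open>The slack \<open>e / 2\<close> keeps both weights positive even if a norm
    vanishes.\<close>
  define A B where "A = L2_norm M f + e / 2" and "B = L2_norm M g + e / 2"
  have A: "0 < A" and B: "0 < B"
    using e by (auto simp: A_def B_def L2_norm_def add_nonneg_pos)
  have "(\<integral>x. (f x)\<^sup>2 \<partial>M) = (L2_norm M f)\<^sup>2" "(\<integral>x. (g x)\<^sup>2 \<partial>M) = (L2_norm M g)\<^sup>2"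
    by (auto simp: L2_norm_def)
  moreover have "0 \<le> L2_norm M f" "0 \<le> L2_norm M g"
    by (auto simp: L2_norm_def)
  ultimately have f2: "(\<integral>x. (f x)\<^sup>2 \<partial>M) \<le> A\<^sup>2" and g2: "(\<integral>x. (g x)\<^sup>2 \<partial>M) \<le> B\<^sup>2"
    using e by (auto simp: A_def B_def intro!: power_mono)
  have weighted: "(u + v)\<^sup>2 \<le> (A + B) / A * u\<^sup>2 + (A + B) / B * v\<^sup>2" for u v :: real
  proof -
    have "(A + B) / A * u\<^sup>2 + (A + B) / B * v\<^sup>2 - (u + v)\<^sup>2 = (B * u - A * v)\<^sup>2 / (A * B)"
      using A B by (simp add: field_simps power2_eq_square)
    also have "\<dots> \<ge> 0"
      using A B by simp
    finally show ?thesis by simp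
  qed
  have "(\<integral>x. (f x + g x)\<^sup>2 \<partial>M) \<le> (\<integral>x. (A + B) / A * (f x)\<^sup>2 + (A + B) / B * (g x)\<^sup>2 \<partial>M)"
  proof (rule integral_mono_AE')
    show "integrable M (\<lambda>x. (A + B) / A * (f x)\<^sup>2 + (A + B) / B * (g x)\<^sup>2)"
      using f g by simp
    show "AE x in M. (f x + g x)\<^sup>2 \<le> (A + B) / A * (f x)\<^sup>2 + (A + B) / B * (g x)\<^sup>2"
      using weighted by blast
    show "AE x in M. 0 \<le> (A + B) / A * (f x)\<^sup>2 + (A + B) / B * (g x)\<^sup>2"
      using A B by (intro AE_I2 add_nonneg_nonneg mult_nonneg_nonneg) auto
  qed
  also have "\<dots> = (A + B) / A * (\<integral>x. (f x)\<^sup>2 \<partial>M) + (A + B) / B * (\<integral>x. (g x)\<^sup>2 \<partial>M)"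
    using f g by simp
  also have "\<dots> \<le> (A + B) / A * A\<^sup>2 + (A + B) / B * B\<^sup>2"
    using A B f2 g2 by (intro add_mono mult_left_mono) auto
  also have "\<dots> = (A + B)\<^sup>2"
    using A B by (simp add: field_simps power2_eq_square)
  finally have "L2_norm M (\<lambda>x. f x + g x) \<le> A + B"
    unfolding L2_norm_def using A B by (intro real_le_lsqrt) auto
  then show "L2_norm M (\<lambda>x. f x + g x) \<le> L2_norm M f + L2_norm M g + e"
    by (simp add: A_def B_def)
qed

subsection \<open>Likelihood ratios of Poisson laws\<close>

text \<open>The right-hand side is minus the relative entropy of Poisson(\<open>a\<close>) with
  respect to Poisson(\<open>b\<close>). As a function of \<open>t = b\<close>, the difference
  \<open>F\<close> of the two sides vanishes at \<open>a\<close>, and its derivative has the sign of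
  \<open>t - a\<close> as long as \<open>t \<ge> m\<close>. So \<open>F\<close> is minimal at
  \<open>a\<close>.\<close>

lemma kl_poisson_le:
  fixes a b m :: real
  assumes m: "0 < m" "m \<le> a" "m \<le> b"
  shows "- ((a - b)\<^sup>2 / (2 * m)) \<le> a - b + a * ln (b / a)"
proof -
  define F where "F t = a - t + a * (ln t - ln a) + (a - t)\<^sup>2 / (2 * m)" for t
  have F': "(F has_real_derivative (t - a) * (1 / m - 1 / t)) (at t)" if "0 < t" for t
    unfolding F_def
    by (rule derivative_eq_intros refl | use that m in \<open>simp add: field_simps\<close>)+
  have "F a \<le> F b"
  proof (cases "a \<le> b")
    case True
    show ?thesis
    proof (rule DERIV_nonneg_imp_nondecreasing[OF True])
      fix t assume "a \<le> t" "t \<le> b"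
      then show "\<exists>y. (F has_real_derivative y) (at t) \<and> 0 \<le> y"
        using m by (intro exI[of _ "(t - a) * (1 / m - 1 / t)"] conjI F' mult_nonneg_nonneg) (auto simp: field_simps)
    qed
  next
    case False
    then have "b \<le> a" by simp
    then show ?thesis
    proof (rule DERIV_nonpos_imp_nonincreasing)
      fix t assume "b \<le> t" "t \<le> a"
      then show "\<exists>y. (F has_real_derivative y) (at t) \<and> y \<le> 0"
        using m by (intro exI[of _ "(t - a) * (1 / m - 1 / t)"] conjI F' mult_nonpos_nonneg) (auto simp: field_simps)
    qed
  qed
  then show ?thesis
    using m by (simp add: F_def ln_div)
qed

text \<open>The tangent of \<open>ln\<close> at \<open>exp 1\<close> passes through the origin. This
  is the source of the constant 1 / e in the final bound.\<close>

lemma ln_le_div_e: "ln x \<le> x / exp 1" if "0 < x" for x :: real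
  using ln_le_minus_one[of "x / exp 1"] that by (simp add: ln_div)

text \<open>
  With \<open>X = ln (min 1 R)\<close> one has \<open>X \<ge> ln R - R / e\<close>, and \<open>exp X \<ge> exp t * (1 + X - t)\<close>; choosing
  \<open>t\<close> as the resulting lower bound of the expectation of \<open>X\<close> gives the estimate.
\<close>
lemma expectation_min_one_ge:
  fixes R :: "'a \<Rightarrow> real"
  assumes R_pos: "\<And>s. s \<in> set_pmf p \<Longrightarrow> 0 < R s"
    and R_int: "integrable (measure_pmf p) R" "(\<integral>s. R s \<partial>measure_pmf p) \<le> 1"
    and ln_int: "integrable (measure_pmf p) (\<lambda>s. ln (R s))" "- K \<le> (\<integral>s. ln (R s) \<partial>measure_pmf p)"
  shows "exp (- (1 / exp 1) - K) \<le> (\<integral>s. min 1 (R s) \<partial>measure_pmf p)"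
proof -
  define t where "t = - (1 / exp 1) - K"
  have pointwise: "exp t * (1 + ln r - r / exp 1 - t) \<le> min 1 r" if r: "0 < r" for r :: real
  proof -
    have tangent: "exp t * (1 + X - t) \<le> exp X" for X
    proof -
      have "exp t * (1 + (X - t)) \<le> exp t * exp (X - t)"
        by (intro mult_left_mono exp_ge_add_one_self) simp
      then show ?thesis by (simp add: exp_diff algebra_simps)
    qed
    have "exp t * (1 + ln r - r / exp 1 - t) \<le> exp t * (1 + ln (min 1 r) - t)"
    proof (rule mult_left_mono)
      \<comment> \<open>For \<open>r \<le> 1\<close> a positive term is dropped; for
        \<open>r > 1\<close> the logarithm of the minimum is 0 and
        \<open>ln r \<le> r / exp 1\<close> applies.\<close>
      show "1 + ln r - r / exp 1 - t \<le> 1 + ln (min 1 r) - t"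
        using ln_le_div_e[OF r] r by (auto simp: min_def)
    qed simp
    also have "\<dots> \<le> min 1 r"
      using tangent[of "ln (min 1 r)"] r by simp
    finally show ?thesis .
  qed
  have "exp t \<le> exp t * (1 + (\<integral>s. ln (R s) \<partial>measure_pmf p) - (\<integral>s. R s \<partial>measure_pmf p) / exp 1 - t)"
  proof -
    have "(\<integral>s. R s \<partial>measure_pmf p) / exp 1 \<le> 1 / exp 1"
      using R_int(2) by (intro divide_right_mono) auto
    then have "1 \<le> 1 + (\<integral>s. ln (R s) \<partial>measure_pmf p) - (\<integral>s. R s \<partial>measure_pmf p) / exp 1 - t"
      using ln_int(2) by (simp add: t_def)
    then show ?thesis by simp
  qed
  also have "\<dots> = (\<integral>s. exp t * (1 + ln (R s) - R s / exp 1 - t) \<partial>measure_pmf p)"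
    using R_int(1) ln_int(1) by simp
  also have "\<dots> \<le> (\<integral>s. min 1 (R s) \<partial>measure_pmf p)"
  proof (rule integral_mono_AE)
    show "integrable (measure_pmf p) (\<lambda>s. min 1 (R s))"
      using R_pos by (intro measure_pmf.integrable_const_bound[where B=1]) (auto simp: AE_measure_pmf_iff abs_if min_def dest!: R_pos)
  qed (use R_int(1) ln_int(1) pointwise R_pos in \<open>auto simp: AE_measure_pmf_iff\<close>)
  finally show ?thesis by (simp add: t_def)
qed

text \<open>The identity \<open>(k + 1) p(k + 1) = r p(k)\<close> for the point masses reduces the
  mean to \<open>r\<close> times the total mass, after the vanishing term at 0 is split off.\<close>

lemma poisson_pmf_mean:
  fixes r :: real
  assumes r: "0 < r"
  shows "has_bochner_integral (measure_pmf (poisson_pmf r)) real r"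
proof (rule has_bochner_integral_nn_integral)
  have "(\<integral>\<^sup>+k. ennreal (real k) \<partial>measure_pmf (poisson_pmf r)) =
      (\<Sum>k. ennreal (pmf (poisson_pmf r) k * real k))"
    by (simp add: nn_integral_measure_pmf nn_integral_count_space_nat ennreal_mult)
  also have "\<dots> = (\<Sum>k. ennreal (pmf (poisson_pmf r) (Suc k) * real (Suc k)))"
    by (subst suminf_offset[where i=1]) (auto simp del: pmf_poisson)
  also have "\<dots> = (\<Sum>k. ennreal r * ennreal (pmf (poisson_pmf r) k))"
    using r by (intro suminf_cong)
      (simp add: ennreal_mult[symmetric] fact_Suc mult_ac del: of_nat_Suc fact_mono_nat)
  also have "\<dots> = ennreal r * (\<Sum>k. ennreal (pmf (poisson_pmf r) k))"
    by simp
  also have "(\<Sum>k. ennreal (pmf (poisson_pmf r) k)) = (\<integral>\<^sup>+k. 1 \<partial>measure_pmf (poisson_pmf r))"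
    by (simp only: nn_integral_measure_pmf nn_integral_count_space_nat mult_1_right)
  also have "\<dots> = 1"
    by simp
  finally show "(\<integral>\<^sup>+k. ennreal (real k) \<partial>measure_pmf (poisson_pmf r)) = ennreal r"
    by simp
qed (use r in auto)

text \<open>The likelihood ratio at \<open>s\<close> of the product Poisson law with rates
  \<open>b\<close> against the one with rates \<open>a\<close>; the factorials cancel.\<close>

definition poisson_lr :: "'i set \<Rightarrow> ('i \<Rightarrow> real) \<Rightarrow> ('i \<Rightarrow> real) \<Rightarrow> ('i \<Rightarrow> nat) \<Rightarrow> real" where
  "poisson_lr I a b s = (\<Prod>i\<in>I. exp (a i - b i) * (b i / a i) ^ s i)"

lemma poisson_lr_pos:
  assumes "\<And>i. i \<in> I \<Longrightarrow> 0 < a i" "\<And>i. i \<in> I \<Longrightarrow> 0 < b i"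
  shows "0 < poisson_lr I a b s"
  unfolding poisson_lr_def using assms by (intro prod_pos ballI mult_pos_pos zero_less_power divide_pos_pos) auto

lemma poisson_lr_swap:
  assumes "\<And>i. i \<in> I \<Longrightarrow> 0 < a i" "\<And>i. i \<in> I \<Longrightarrow> 0 < b i"
  shows "poisson_lr I b a s = 1 / poisson_lr I a b s"
proof -
  have "poisson_lr I b a s * poisson_lr I a b s = 1"
    unfolding poisson_lr_def prod.distrib[symmetric]
    using assms by (intro prod.neutral) (auto simp: exp_diff power_divide divide_simps dest: less_imp_neq[symmetric])
  then show ?thesis
    using poisson_lr_pos[of I a b s] assms by (simp add: divide_simps)
qed

lemma pmf_Pi_poisson_lr:
  assumes I: "finite I" and a: "\<And>i. i \<in> I \<Longrightarrow> 0 < a i" and b: "\<And>i. i \<in> I \<Longrightarrow> 0 < b i"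
  shows "pmf (Pi_pmf I 0 (\<lambda>i. poisson_pmf (b i))) s =
    pmf (Pi_pmf I 0 (\<lambda>i. poisson_pmf (a i))) s * poisson_lr I a b s"
proof -
  have "pmf (poisson_pmf (b i)) (s i) = pmf (poisson_pmf (a i)) (s i) * (exp (a i - b i) * (b i / a i) ^ s i)"
    if "i \<in> I" for i
    using a[OF that] b[OF that] by (simp add: exp_diff exp_minus power_divide divide_simps)
  then show ?thesis
    using I by (auto simp: pmf_Pi poisson_lr_def prod.distrib[symmetric] intro!: prod.cong)
qed

text \<open>Change of measure: the expectation of the likelihood ratio under rates \<open>a\<close>
  is the total mass of the law with rates \<open>b\<close>.\<close>

lemma poisson_lr_mean:
  fixes a b :: "'i \<Rightarrow> real"
  assumes I: "finite I" and a: "\<And>i. i \<in> I \<Longrightarrow> 0 < a i" and b: "\<And>i. i \<in> I \<Longrightarrow> 0 < b i"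
  shows "has_bochner_integral (measure_pmf (Pi_pmf I 0 (\<lambda>i. poisson_pmf (a i)))) (poisson_lr I a b) 1"
proof (rule has_bochner_integral_nn_integral)
  have "(\<integral>\<^sup>+s. ennreal (poisson_lr I a b s) \<partial>measure_pmf (Pi_pmf I 0 (\<lambda>i. poisson_pmf (a i)))) =
      (\<integral>\<^sup>+s. ennreal (pmf (Pi_pmf I 0 (\<lambda>i. poisson_pmf (b i))) s) \<partial>count_space UNIV)"
    unfolding nn_integral_measure_pmf
    by (intro nn_integral_cong)
      (simp add: pmf_Pi_poisson_lr[OF I a b] ennreal_mult less_imp_le[OF poisson_lr_pos[OF a b]])
  also have "\<dots> = (\<integral>\<^sup>+s. 1 \<partial>measure_pmf (Pi_pmf I 0 (\<lambda>i. poisson_pmf (b i))))"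
    by (simp only: nn_integral_measure_pmf mult_1_right)
  finally show "(\<integral>\<^sup>+s. ennreal (poisson_lr I a b s) \<partial>measure_pmf (Pi_pmf I 0 (\<lambda>i. poisson_pmf (a i)))) = ennreal 1"
    by simp
qed (auto intro: less_imp_le poisson_lr_pos a b)

lemma integrable_min_one:
  fixes R :: "'s \<Rightarrow> real"
  assumes "\<And>s. 0 \<le> R s"
  shows "integrable (measure_pmf p) (\<lambda>s. min 1 (R s))"
  using assms by (intro measure_pmf.integrable_const_bound[where B=1]) auto

text \<open>Both sides are \<open>\<Sum>s. min (X p(s)) (X' p'(s))\<close> for the two product Poisson laws \<open>p\<close>, \<open>p'\<close>.\<close>
lemma expectation_min_poisson_lr_swap:
  fixes a b :: "'i \<Rightarrow> real"
  assumes I: "finite I" and a: "\<And>i. i \<in> I \<Longrightarrow> 0 < a i" and b: "\<And>i. i \<in> I \<Longrightarrow> 0 < b i"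
    and X: "0 < X" and X': "0 < X'"
  shows "X * (\<integral>s. min 1 (X' / X * poisson_lr I a b s) \<partial>measure_pmf (Pi_pmf I 0 (\<lambda>i. poisson_pmf (a i)))) =
    X' * (\<integral>s. min 1 (X / X' * poisson_lr I b a s) \<partial>measure_pmf (Pi_pmf I 0 (\<lambda>i. poisson_pmf (b i))))"
proof -
  define p where "p = Pi_pmf I 0 (\<lambda>i. poisson_pmf (a i))"
  define p' where "p' = Pi_pmf I 0 (\<lambda>i. poisson_pmf (b i))"
  have pos: "0 < poisson_lr I a b s" "0 < poisson_lr I b a s" for s
    using a b by (auto intro: poisson_lr_pos)
  have eq: "ennreal (Y * (\<integral>s. min 1 (R s) \<partial>measure_pmf r)) =
      (\<integral>\<^sup>+s. ennreal (Y * (pmf r s * min 1 (R s))) \<partial>count_space UNIV)"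
    if "\<And>s. 0 \<le> R s" "0 < Y" for Y and R :: "('i \<Rightarrow> nat) \<Rightarrow> real" and r
  proof -
    have "ennreal (\<integral>s. min 1 (R s) \<partial>measure_pmf r) = (\<integral>\<^sup>+s. ennreal (min 1 (R s)) \<partial>measure_pmf r)"
      using that by (intro nn_integral_eq_integral[symmetric] integrable_min_one) auto
    then show ?thesis
      using that by (simp add: nn_integral_measure_pmf ennreal_mult' nn_integral_cmult)
  qed
  have "X * (pmf p s * min 1 (X' / X * poisson_lr I a b s)) =
      X' * (pmf p' s * min 1 (X / X' * poisson_lr I b a s))" for s
  proof -
    have "X * (pmf p s * min 1 (X' / X * poisson_lr I a b s)) = pmf p s * min X (X' * poisson_lr I a b s)"
      using X by (simp add: min_mult_distrib_left mult_ac)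
    also have "\<dots> = pmf p s * poisson_lr I a b s * min (X * poisson_lr I b a s) X'"
      using pos[of s] by (simp add: min_mult_distrib_left poisson_lr_swap[OF a b] mult_ac)
    also have "\<dots> = pmf p' s * min (X * poisson_lr I b a s) X'"
      by (simp add: p_def p'_def pmf_Pi_poisson_lr[OF I a b])
    also have "\<dots> = X' * (pmf p' s * min 1 (X / X' * poisson_lr I b a s))"
      using X' by (simp add: min_mult_distrib_left min.commute mult_ac)
    finally show ?thesis .
  qed
  then have "ennreal (X * (\<integral>s. min 1 (X' / X * poisson_lr I a b s) \<partial>measure_pmf p)) =
      ennreal (X' * (\<integral>s. min 1 (X / X' * poisson_lr I b a s) \<partial>measure_pmf p'))"
    using X X' pos by (subst (1 2) eq) (auto intro: less_imp_le)
  moreover have "0 \<le> X * (\<integral>s. min 1 (X' / X * poisson_lr I a b s) \<partial>measure_pmf p)"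
    "0 \<le> X' * (\<integral>s. min 1 (X / X' * poisson_lr I b a s) \<partial>measure_pmf p')"
    using X X' pos by (auto intro!: mult_nonneg_nonneg integral_nonneg_AE simp: less_imp_le)
  ultimately show ?thesis
    by (simp add: p_def p'_def)
qed

text \<open>The likelihood ratio has mean 1, and the mean of its logarithm is minus the sum of the
  coordinatewise relative entropies. \<open>kl_poisson_le\<close> bounds each of them through the
  common lower bound \<open>m i\<close> of the two rates.\<close>

lemma expectation_min_poisson_lr_ge:
  fixes a b m :: "'i \<Rightarrow> real"
  assumes I: "finite I" and m: "\<And>i. i \<in> I \<Longrightarrow> 0 < m i \<and> m i \<le> a i \<and> m i \<le> b i"
  shows "exp (- (1 / exp 1) - (\<Sum>i\<in>I. (a i - b i)\<^sup>2 / (2 * m i)))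
    \<le> (\<integral>s. min 1 (poisson_lr I a b s) \<partial>measure_pmf (Pi_pmf I 0 (\<lambda>i. poisson_pmf (a i))))"
proof -
  define p where "p = Pi_pmf I 0 (\<lambda>i. poisson_pmf (a i))"
  let ?R = "poisson_lr I a b"
  have a: "0 < a i" and b: "0 < b i" if "i \<in> I" for i
    using m[OF that] by auto
  have R_pos: "0 < ?R s" for s
    using a b by (rule poisson_lr_pos)
  have R_int: "has_bochner_integral (measure_pmf p) ?R 1"
    unfolding p_def using I a b by (rule poisson_lr_mean)
  have s_int: "has_bochner_integral (measure_pmf p) (\<lambda>s. real (s i)) (a i)" if "i \<in> I" for i
  proof -
    \<comment> \<open>The mean of one coordinate is read off from its marginal law.\<close>
    have "map_pmf (\<lambda>s. s i) p = poisson_pmf (a i)"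
      using I that by (simp add: p_def Pi_pmf_component)
    then show ?thesis
      using poisson_pmf_mean[OF a[OF that]]
      by (metis has_bochner_integral_iff integrable_map_pmf_eq integral_map_pmf)
  qed
  have "a i \<noteq> 0" "b i \<noteq> 0" if "i \<in> I" for i
    using a[OF that] b[OF that] by auto
  then have ln_R: "ln (?R s) = (\<Sum>i\<in>I. (a i - b i) + real (s i) * ln (b i / a i))" for s
    unfolding poisson_lr_def using I a b
    by (subst ln_prod) (auto simp: ln_mult ln_realpow intro!: sum.cong)
  have ln_int: "has_bochner_integral (measure_pmf p) (\<lambda>s. ln (?R s)) (\<Sum>i\<in>I. (a i - b i) + a i * ln (b i / a i))"
    unfolding ln_R
    by (intro has_bochner_integral_sum has_bochner_integral_add has_bochner_integral_mult_left)
      (auto simp: has_bochner_integral_iff s_int[unfolded has_bochner_integral_iff])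
  have "- (\<Sum>i\<in>I. (a i - b i)\<^sup>2 / (2 * m i)) \<le> (\<Sum>i\<in>I. (a i - b i) + a i * ln (b i / a i))"
    unfolding sum_negf[symmetric] using m by (intro sum_mono kl_poisson_le) auto
  then show ?thesis
    using R_int ln_int R_pos unfolding p_def[symmetric]
    by (intro expectation_min_one_ge) (auto simp: has_bochner_integral_iff)
qed

subsection \<open>Reversible kernels given by jump densities\<close>

lemma nn_integral_bool_pmf:
  fixes g :: "bool \<Rightarrow> ennreal"
  shows "(\<integral>\<^sup>+b. g b \<partial>measure_pmf p) = ennreal (pmf p True) * g True + ennreal (1 - pmf p True) * g False"
  by (subst nn_integral_measure_pmf_support[of UNIV]) (auto simp: UNIV_bool pmf_False_conv_True mult.commute)

locale positive_density = sigma_finite_measure \<nu> for \<nu> :: "'a measure" +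
  fixes w :: "'a \<Rightarrow> real"
  assumes w_measurable [measurable]: "w \<in> borel_measurable \<nu>"
    and w_pos: "\<And>x. x \<in> space \<nu> \<Longrightarrow> 0 < w x"
begin

definition "\<mu> = density \<nu> (\<lambda>x. ennreal (w x))"

lemma space_\<mu> [simp]: "space \<mu> = space \<nu>" and sets_\<mu> [measurable_cong, simp]: "sets \<mu> = sets \<nu>"
  by (auto simp: \<mu>_def)

lemma measurable_\<mu> [simp]: "borel_measurable \<mu> = borel_measurable \<nu>"
  by (intro measurable_cong_sets) auto

text \<open>
  \<open>h\<close> is the jump density of a \<open>\<mu>\<close>-reversible kernel of total mass \<open>m\<close>: the mass
  \<open>m - \<integral> h x y d\<nu>(y)\<close> not used for jumps stays at \<open>x\<close>.
\<close>
definition reversible_rate :: "real \<Rightarrow> ('a \<Rightarrow> 'a \<Rightarrow> real) \<Rightarrow> bool" where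
  "reversible_rate m h \<longleftrightarrow>
     (\<lambda>(x, y). h x y) \<in> borel_measurable (\<nu> \<Otimes>\<^sub>M \<nu>) \<and>
     (\<forall>x\<in>space \<nu>. \<forall>y\<in>space \<nu>. 0 \<le> h x y \<and> w x * h x y = w y * h y x) \<and>
     (\<forall>x\<in>space \<nu>. (\<integral>\<^sup>+y. ennreal (h x y) \<partial>\<nu>) \<le> ennreal m)"

definition jump_mass :: "('a \<Rightarrow> 'a \<Rightarrow> real) \<Rightarrow> 'a \<Rightarrow> real" where
  "jump_mass h x = (\<integral>y. h x y \<partial>\<nu>)"

text \<open>The action on functions of the kernel that jumps with density \<open>h\<close> and holds
  the remaining mass. The total mass \<open>m\<close> is a parameter so that the remainder
  \<open>P_aux - \<kappa> P_ideal\<close>, of mass \<open>1 - \<kappa>\<close>, is covered as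
  well.\<close>

definition jump_op :: "real \<Rightarrow> ('a \<Rightarrow> 'a \<Rightarrow> real) \<Rightarrow> ('a \<Rightarrow> real) \<Rightarrow> 'a \<Rightarrow> real" where
  "jump_op m h f x = (\<integral>y. h x y * f y \<partial>\<nu>) + (m - jump_mass h x) * f x"

context
  fixes m :: real and h :: "'a \<Rightarrow> 'a \<Rightarrow> real"
  assumes m: "0 < m" and rate: "reversible_rate m h"
begin

lemma rate_measurable [measurable]: "(\<lambda>(x, y). h x y) \<in> borel_measurable (\<nu> \<Otimes>\<^sub>M \<nu>)"
  and rate_nonneg: "\<And>x y. x \<in> space \<nu> \<Longrightarrow> y \<in> space \<nu> \<Longrightarrow> 0 \<le> h x y"
  and rate_sym: "\<And>x y. x \<in> space \<nu> \<Longrightarrow> y \<in> space \<nu> \<Longrightarrow> w x * h x y = w y * h y x"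
  and rate_mass: "\<And>x. x \<in> space \<nu> \<Longrightarrow> (\<integral>\<^sup>+y. ennreal (h x y) \<partial>\<nu>) \<le> ennreal m"
  using rate by (auto simp: reversible_rate_def)

lemma rate_integrable: "x \<in> space \<nu> \<Longrightarrow> integrable \<nu> (h x)"
  using rate_mass[of x] by (intro integrableI_nonneg) (auto simp: rate_nonneg top.not_eq_extremum le_less_trans)

lemma jump_mass_measurable [measurable]: "jump_mass h \<in> borel_measurable \<nu>"
  unfolding jump_mass_def[abs_def] by measurable

lemma jump_mass_eq: "x \<in> space \<nu> \<Longrightarrow> (\<integral>\<^sup>+y. ennreal (h x y) \<partial>\<nu>) = ennreal (jump_mass h x)"
  unfolding jump_mass_def by (intro nn_integral_eq_integral rate_integrable) (auto simp: rate_nonneg)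

lemma jump_mass_bounds:
  assumes "x \<in> space \<nu>"
  shows "0 \<le> jump_mass h x" "jump_mass h x \<le> m"
proof -
  show "0 \<le> jump_mass h x"
    unfolding jump_mass_def using assms by (intro integral_nonneg_AE AE_I2) (auto simp: rate_nonneg)
  show "jump_mass h x \<le> m"
    using rate_mass[OF assms] jump_mass_eq[OF assms] m by (simp add: ennreal_le_iff)
qed

lemma jump_op_measurable [measurable]:
  assumes [measurable]: "f \<in> borel_measurable \<nu>"
  shows "jump_op m h f \<in> borel_measurable \<nu>"
  unfolding jump_op_def[abs_def] by measurable

text \<open>Invariance of \<open>\<mu>\<close> up to the factor \<open>m\<close>: detailed balance
  and Tonelli turn the jump part into the integral of \<open>jump_mass h y * g y\<close>, which the
  holding part completes to \<open>m * g y\<close>. Working with nonnegative integrals avoids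
  integrability conditions.\<close>

lemma jump_kernel_invariant:
  assumes [measurable]: "g \<in> borel_measurable \<nu>" and g: "\<And>x. x \<in> space \<nu> \<Longrightarrow> 0 \<le> g x"
  shows "(\<integral>\<^sup>+x. (\<integral>\<^sup>+y. ennreal (h x y * g y) \<partial>\<nu>) + ennreal ((m - jump_mass h x) * g x) \<partial>\<mu>) =
    ennreal m * (\<integral>\<^sup>+x. ennreal (g x) \<partial>\<mu>)"
proof -
  interpret pair_sigma_finite \<nu> \<nu>
    by unfold_locales
  have "(\<integral>\<^sup>+x. (\<integral>\<^sup>+y. ennreal (h x y * g y) \<partial>\<nu>) \<partial>\<mu>) =
      (\<integral>\<^sup>+x. ennreal (w x) * (\<integral>\<^sup>+y. ennreal (h x y * g y) \<partial>\<nu>) \<partial>\<nu>)"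
    unfolding \<mu>_def by (rule nn_integral_density) measurable
  also have "\<dots> = (\<integral>\<^sup>+x. (\<integral>\<^sup>+y. ennreal (w x) * ennreal (h x y * g y) \<partial>\<nu>) \<partial>\<nu>)"
    by (intro nn_integral_cong nn_integral_cmult[symmetric]) measurable
  also have "\<dots> = (\<integral>\<^sup>+x. (\<integral>\<^sup>+y. ennreal (w y * g y) * ennreal (h y x) \<partial>\<nu>) \<partial>\<nu>)"
  proof (intro nn_integral_cong)
    fix x y assume xy: "x \<in> space \<nu>" "y \<in> space \<nu>"
    have "w x * (h x y * g y) = w y * g y * h y x"
      using rate_sym[OF xy] by (metis mult.assoc mult.commute)
    then show "ennreal (w x) * ennreal (h x y * g y) = ennreal (w y * g y) * ennreal (h y x)"
      using xy w_pos[OF xy(1)] w_pos[OF xy(2)] g[OF xy(2)] rate_nonneg[OF xy] rate_nonneg[OF xy(2,1)]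
      by (simp add: ennreal_mult[symmetric])
  qed
  also have "\<dots> = (\<integral>\<^sup>+y. (\<integral>\<^sup>+x. ennreal (w y * g y) * ennreal (h y x) \<partial>\<nu>) \<partial>\<nu>)"
    by (rule Fubini'[symmetric]) measurable
  also have "\<dots> = (\<integral>\<^sup>+y. ennreal (w y * g y) * ennreal (jump_mass h y) \<partial>\<nu>)"
    by (intro nn_integral_cong) (simp add: nn_integral_cmult jump_mass_eq)
  also have "\<dots> = (\<integral>\<^sup>+y. ennreal (w y) * ennreal (jump_mass h y * g y) \<partial>\<nu>)"
    by (intro nn_integral_cong)
      (simp add: ennreal_mult[symmetric] jump_mass_bounds g w_pos less_imp_le mult_ac)
  also have "\<dots> = (\<integral>\<^sup>+y. ennreal (jump_mass h y * g y) \<partial>\<mu>)"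
    unfolding \<mu>_def by (rule nn_integral_density[symmetric]) measurable
  finally have jumps: "(\<integral>\<^sup>+x. (\<integral>\<^sup>+y. ennreal (h x y * g y) \<partial>\<nu>) \<partial>\<mu>) =
    (\<integral>\<^sup>+y. ennreal (jump_mass h y * g y) \<partial>\<mu>)" .
  have "(\<integral>\<^sup>+x. (\<integral>\<^sup>+y. ennreal (h x y * g y) \<partial>\<nu>) + ennreal ((m - jump_mass h x) * g x) \<partial>\<mu>) =
      (\<integral>\<^sup>+x. ennreal (jump_mass h x * g x) \<partial>\<mu>) + (\<integral>\<^sup>+x. ennreal ((m - jump_mass h x) * g x) \<partial>\<mu>)"
    unfolding jumps[symmetric] by (rule nn_integral_add) measurable
  also have "\<dots> = (\<integral>\<^sup>+x. ennreal (jump_mass h x * g x) + ennreal ((m - jump_mass h x) * g x) \<partial>\<mu>)"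
    by (rule nn_integral_add[symmetric]) measurable
  also have "\<dots> = (\<integral>\<^sup>+x. ennreal m * ennreal (g x) \<partial>\<mu>)"
  proof (intro nn_integral_cong)
    fix x assume "x \<in> space \<mu>"
    then have x: "x \<in> space \<nu>" by simp
    have "ennreal (jump_mass h x * g x) + ennreal ((m - jump_mass h x) * g x) =
        ennreal (jump_mass h x * g x + (m - jump_mass h x) * g x)"
      using jump_mass_bounds[OF x] g[OF x] by (intro ennreal_plus[symmetric]) auto
    also have "jump_mass h x * g x + (m - jump_mass h x) * g x = m * g x"
      by (simp add: algebra_simps)
    also have "ennreal (m * g x) = ennreal m * ennreal (g x)"
      using m g[OF x] by (simp add: ennreal_mult)
    finally show "ennreal (jump_mass h x * g x) + ennreal ((m - jump_mass h x) * g x) = ennreal m * ennreal (g x)" .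
  qed
  also have "\<dots> = ennreal m * (\<integral>\<^sup>+x. ennreal (g x) \<partial>\<mu>)"
    by (rule nn_integral_cmult) measurable
  finally show ?thesis .
qed

text \<open>Jensen's inequality for the square under the kernel at \<open>x\<close>, obtained from
  the nonnegativity of the second moment of \<open>f\<close> about its mean \<open>t\<close>. The
  factor \<open>m\<close> accounts for the total mass.\<close>

lemma square_jump_op_le:
  assumes [measurable]: "f \<in> borel_measurable \<nu>" and x: "x \<in> space \<nu>"
    and int: "integrable \<nu> (\<lambda>y. h x y * (f y)\<^sup>2)"
  shows "(jump_op m h f x)\<^sup>2 \<le> m * ((\<integral>y. h x y * (f y)\<^sup>2 \<partial>\<nu>) + (m - jump_mass h x) * (f x)\<^sup>2)"
proof -
  \<comment> \<open>Dividing by \<open>m\<close> normalises the kernel, so \<open>t\<close> is the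
    mean of \<open>f\<close> after one step from \<open>x\<close>.\<close>
  define E F H t where "E = (\<integral>y. h x y * f y \<partial>\<nu>)" and "F = (\<integral>y. h x y * (f y)\<^sup>2 \<partial>\<nu>)"
    and "H = jump_mass h x" and "t = jump_op m h f x / m"
  have intf: "integrable \<nu> (\<lambda>y. h x y * f y)"
    by (rule integrable_mult_of_nonneg_squares[OF assms(1) _ _ int]) (use x in \<open>auto simp: rate_integrable rate_nonneg\<close>)
  have mt: "m * t = E + (m - H) * f x"
    using m by (simp add: t_def jump_op_def E_def H_def)
  have "0 \<le> (\<integral>y. h x y * (f y - t)\<^sup>2 \<partial>\<nu>)"
    using x by (intro integral_nonneg_AE AE_I2) (auto simp: rate_nonneg)
  also have "(\<integral>y. h x y * (f y - t)\<^sup>2 \<partial>\<nu>) = (\<integral>y. h x y * (f y)\<^sup>2 - 2 * t * (h x y * f y) + t\<^sup>2 * h x y \<partial>\<nu>)"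
    by (intro Bochner_Integration.integral_cong) (auto simp: power2_eq_square algebra_simps)
  also have "\<dots> = F - 2 * t * E + t\<^sup>2 * H"
    using int intf rate_integrable[OF x] by (simp add: E_def F_def H_def jump_mass_def)
  finally have "0 \<le> F - 2 * t * E + t\<^sup>2 * H" .
  moreover have "0 \<le> (m - H) * (f x - t)\<^sup>2"
    using jump_mass_bounds[OF x] by (simp add: H_def)
  ultimately have "0 \<le> F + (m - H) * (f x)\<^sup>2 - 2 * t * (E + (m - H) * f x) + m * t\<^sup>2"
    by (simp add: power2_eq_square algebra_simps)
  also have "\<dots> = F + (m - H) * (f x)\<^sup>2 - m * t\<^sup>2"
    unfolding mt[symmetric] by (simp add: power2_eq_square)
  finally have "m * (m * t\<^sup>2) \<le> m * (F + (m - H) * (f x)\<^sup>2)"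
    using m by (intro mult_left_mono) auto
  then show ?thesis
    using m by (simp add: t_def F_def H_def power2_eq_square)
qed

text \<open>Integrating the pointwise Jensen bound against \<open>\<mu>\<close> and applying
  invariance to the square of \<open>f\<close> yields one factor \<open>m\<close> from each, hence
  the norm bound \<open>m\<close>.\<close>

lemma
  assumes [measurable]: "f \<in> borel_measurable \<nu>" and f2: "integrable \<mu> (\<lambda>x. (f x)\<^sup>2)"
  shows AE_rate_integrable: "AE x in \<mu>. integrable \<nu> (\<lambda>y. h x y * (f y)\<^sup>2)"
    and jump_op_square_integrable: "integrable \<mu> (\<lambda>x. (jump_op m h f x)\<^sup>2)"
    and L2_norm_jump_op_le: "L2_norm \<mu> (jump_op m h f) \<le> m * L2_norm \<mu> f"
proof -
  define G where "G x = (\<integral>\<^sup>+y. ennreal (h x y * (f y)\<^sup>2) \<partial>\<nu>) + ennreal ((m - jump_mass h x) * (f x)\<^sup>2)" for x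
  have [measurable]: "G \<in> borel_measurable \<nu>"
    unfolding G_def[abs_def] by measurable
  have f2': "(\<integral>\<^sup>+x. ennreal ((f x)\<^sup>2) \<partial>\<mu>) = ennreal (\<integral>x. (f x)\<^sup>2 \<partial>\<mu>)"
    using f2 by (intro nn_integral_eq_integral) auto
  have G_int: "(\<integral>\<^sup>+x. G x \<partial>\<mu>) = ennreal (m * (\<integral>x. (f x)\<^sup>2 \<partial>\<mu>))"
    unfolding G_def using m by (subst jump_kernel_invariant) (auto simp: f2' ennreal_mult)
  \<comment> \<open>Finiteness of the integral of \<open>G\<close> is what makes the square of
    \<open>f\<close> integrable against \<open>h x\<close> for almost every \<open>x\<close>; at the
    other points \<open>jump_op\<close> may involve a divergent integral.\<close>
  have "AE x in \<mu>. G x \<noteq> \<infinity>"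
    using G_int by (intro nn_integral_PInf_AE) auto
  then have AE: "AE x in \<mu>. integrable \<nu> (\<lambda>y. h x y * (f y)\<^sup>2) \<and> ennreal ((jump_op m h f x)\<^sup>2) \<le> ennreal m * G x"
  proof (rule AE_mp, intro AE_I2 impI)
    fix x assume "x \<in> space \<mu>" and fin: "G x \<noteq> \<infinity>"
    then have x: "x \<in> space \<nu>" by simp
    have int: "integrable \<nu> (\<lambda>y. h x y * (f y)\<^sup>2)"
      using fin x by (intro integrableI_nonneg) (auto simp: G_def rate_nonneg top.not_eq_extremum)
    moreover have "G x = ennreal ((\<integral>y. h x y * (f y)\<^sup>2 \<partial>\<nu>) + (m - jump_mass h x) * (f x)\<^sup>2)"
      unfolding G_def using int x jump_mass_bounds[OF x]
      by (subst nn_integral_eq_integral) (auto simp: rate_nonneg ennreal_plus[symmetric] integral_nonneg_AE simp del: ennreal_plus)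
    ultimately show "integrable \<nu> (\<lambda>y. h x y * (f y)\<^sup>2) \<and> ennreal ((jump_op m h f x)\<^sup>2) \<le> ennreal m * G x"
      using square_jump_op_le[OF assms(1) x int] m by (simp add: ennreal_mult'[symmetric] ennreal_leI)
  qed
  then show "AE x in \<mu>. integrable \<nu> (\<lambda>y. h x y * (f y)\<^sup>2)"
    by auto
  have "(\<integral>\<^sup>+x. ennreal ((jump_op m h f x)\<^sup>2) \<partial>\<mu>) \<le> (\<integral>\<^sup>+x. ennreal m * G x \<partial>\<mu>)"
    using AE by (intro nn_integral_mono_AE) auto
  also have "\<dots> = ennreal m * ennreal (m * (\<integral>x. (f x)\<^sup>2 \<partial>\<mu>))"
    by (subst nn_integral_cmult) (auto simp: G_int)
  also have "\<dots> = ennreal (m\<^sup>2 * (\<integral>x. (f x)\<^sup>2 \<partial>\<mu>))"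
    using m by (simp add: ennreal_mult'[symmetric] power2_eq_square mult.assoc)
  finally have bound: "(\<integral>\<^sup>+x. ennreal ((jump_op m h f x)\<^sup>2) \<partial>\<mu>) \<le> ennreal (m\<^sup>2 * (\<integral>x. (f x)\<^sup>2 \<partial>\<mu>))" .
  show int: "integrable \<mu> (\<lambda>x. (jump_op m h f x)\<^sup>2)"
    using bound by (intro integrableI_nonneg) (auto simp: le_less_trans)
  have "(\<integral>x. (jump_op m h f x)\<^sup>2 \<partial>\<mu>) \<le> m\<^sup>2 * (\<integral>x. (f x)\<^sup>2 \<partial>\<mu>)"
    using bound nn_integral_eq_integral[OF int] by (simp add: ennreal_le_iff)
  then have "sqrt (\<integral>x. (jump_op m h f x)\<^sup>2 \<partial>\<mu>) \<le> sqrt (m\<^sup>2 * (\<integral>x. (f x)\<^sup>2 \<partial>\<mu>))"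
    by (rule real_sqrt_le_mono)
  then show "L2_norm \<mu> (jump_op m h f) \<le> m * L2_norm \<mu> f"
    using m by (simp add: L2_norm_def real_sqrt_mult)
qed

end

section \<open>Markov kernels with a jump density and their norms\<close>

text \<open>\<open>P x\<close> is the density \<open>h x\<close> plus an atom at \<open>x\<close>.
  Testing with nonnegative functions matches the form in which integrals against a monadic bind are
  computed.\<close>

definition represents :: "('a \<Rightarrow> 'a measure) \<Rightarrow> ('a \<Rightarrow> 'a \<Rightarrow> real) \<Rightarrow> bool" where
  "represents P h \<longleftrightarrow> (\<forall>x\<in>space \<nu>. sets (P x) = sets \<nu> \<and>
     (\<forall>g\<in>borel_measurable \<nu>. (\<integral>\<^sup>+y. g y \<partial>P x) =
        (\<integral>\<^sup>+y. ennreal (h x y) * g y \<partial>\<nu>) + ennreal (1 - jump_mass h x) * g x))"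

text \<open>The atom contributes a finite amount, so integrability under \<open>P x\<close> is
  decided by the jump part. The value 0 is the default of the integral of a nonintegrable function;
  recording it gives a formula at every point, from which measurability of
  \<open>kernel_op P f\<close> follows.\<close>

lemma kernel_op_eq_jump_op:
  assumes rate: "reversible_rate 1 h" and P: "represents P h" and f [measurable]: "f \<in> borel_measurable \<nu>"
    and x: "x \<in> space \<nu>"
  shows "kernel_op P f x = (if integrable \<nu> (\<lambda>y. h x y * f y) then jump_op 1 h f x else 0)"
proof -
  note [measurable] = rate_measurable[OF zero_less_one rate]
  note bounds = jump_mass_bounds[OF zero_less_one rate x]
  note nonneg = rate_nonneg[OF zero_less_one rate x]
  have sets_P: "sets (P x) = sets \<nu>"
    using P x by (auto simp: represents_def)
  then have [measurable]: "f \<in> borel_measurable (P x)"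
    using f measurable_cong_sets[OF sets_P refl] by blast
  have nn: "(\<integral>\<^sup>+y. ennreal (g y) \<partial>P x) = (\<integral>\<^sup>+y. ennreal (h x y * g y) \<partial>\<nu>) + ennreal ((1 - jump_mass h x) * g x)"
    if [measurable]: "g \<in> borel_measurable \<nu>" for g
  proof -
    have "(\<integral>\<^sup>+y. ennreal (h x y) * ennreal (g y) \<partial>\<nu>) = (\<integral>\<^sup>+y. ennreal (h x y * g y) \<partial>\<nu>)"
      by (intro nn_integral_cong) (simp add: ennreal_mult' nonneg)
    then show ?thesis
      using P x bounds by (simp add: represents_def ennreal_mult')
  qed
  have abs: "(\<integral>\<^sup>+y. ennreal (norm (h x y * f y)) \<partial>\<nu>) = (\<integral>\<^sup>+y. ennreal (h x y * \<bar>f y\<bar>) \<partial>\<nu>)"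
    by (intro nn_integral_cong) (simp add: abs_mult nonneg)
  have "integrable (P x) f \<longleftrightarrow> (\<integral>\<^sup>+y. ennreal \<bar>f y\<bar> \<partial>P x) < \<infinity>"
    by (simp add: integrable_iff_bounded)
  also have "\<dots> \<longleftrightarrow> (\<integral>\<^sup>+y. ennreal (norm (h x y * f y)) \<partial>\<nu>) < \<infinity>"
    unfolding abs by (subst nn) simp_all
  also have "\<dots> \<longleftrightarrow> integrable \<nu> (\<lambda>y. h x y * f y)"
    unfolding integrable_iff_bounded using x by simp
  finally have iff: "integrable (P x) f \<longleftrightarrow> integrable \<nu> (\<lambda>y. h x y * f y)" .
  show ?thesis
  proof (cases "integrable \<nu> (\<lambda>y. h x y * f y)")
    case int: True
    define c where "c = (1 - jump_mass h x) * f x"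
    have fin: "(\<integral>\<^sup>+y. ennreal (h x y * f y) \<partial>\<nu>) < top" "(\<integral>\<^sup>+y. ennreal (- (h x y * f y)) \<partial>\<nu>) < top"
      using int real_integrable_def[of \<nu> "\<lambda>y. h x y * f y"] by (auto simp: top.not_eq_extremum)
    \<comment> \<open>\<open>represents\<close> speaks of nonnegative integrals only, so
      \<open>f\<close> is split into positive and negative parts; both are finite and may be
      subtracted.\<close>
    have "kernel_op P f x = enn2real (\<integral>\<^sup>+y. ennreal (f y) \<partial>P x) - enn2real (\<integral>\<^sup>+y. ennreal (- f y) \<partial>P x)"
      unfolding kernel_op_def using int iff by (intro real_lebesgue_integral_def) simp
    also have "(\<integral>\<^sup>+y. ennreal (f y) \<partial>P x) = (\<integral>\<^sup>+y. ennreal (h x y * f y) \<partial>\<nu>) + ennreal c"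
      by (simp add: nn c_def)
    also have "(\<integral>\<^sup>+y. ennreal (- f y) \<partial>P x) = (\<integral>\<^sup>+y. ennreal (- (h x y * f y)) \<partial>\<nu>) + ennreal (- c)"
      by (simp add: nn c_def)
    also have "enn2real ((\<integral>\<^sup>+y. ennreal (h x y * f y) \<partial>\<nu>) + ennreal c)
        - enn2real ((\<integral>\<^sup>+y. ennreal (- (h x y * f y)) \<partial>\<nu>) + ennreal (- c)) =
        enn2real (\<integral>\<^sup>+y. ennreal (h x y * f y) \<partial>\<nu>) - enn2real (\<integral>\<^sup>+y. ennreal (- (h x y * f y)) \<partial>\<nu>)
        + (enn2real (ennreal c) - enn2real (ennreal (- c)))"
      using fin by (simp add: enn2real_plus)
    \<comment> \<open>\<open>ennreal\<close> truncates negative numbers to 0, so at most one of the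
      two terms is nonzero.\<close>
    also have "enn2real (ennreal c) - enn2real (ennreal (- c)) = c"
      by (cases "0 \<le> c") (simp_all add: ennreal_neg)
    finally show ?thesis
      using int by (simp add: jump_op_def real_lebesgue_integral_def[OF int] c_def)
  next
    case False
    then show ?thesis
      using iff by (simp add: kernel_op_def not_integrable_integral_eq)
  qed
qed

text \<open>A square integrable \<open>f\<close> has its square integrable against
  \<open>h x\<close> for almost every \<open>x\<close>, hence also \<open>f\<close> itself; so the
  default value above occurs only on a null set.\<close>

lemma AE_kernel_op:
  assumes rate: "reversible_rate 1 h" and P: "represents P h"
    and f [measurable]: "f \<in> borel_measurable \<nu>" and f2: "integrable \<mu> (\<lambda>x. (f x)\<^sup>2)"
  shows "AE x in \<mu>. integrable \<nu> (\<lambda>y. h x y * f y) \<and> kernel_op P f x = jump_op 1 h f x"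
proof (rule AE_mp[OF AE_rate_integrable[OF zero_less_one rate f f2]], intro AE_I2 impI)
  fix x assume "x \<in> space \<mu>" and int: "integrable \<nu> (\<lambda>y. h x y * (f y)\<^sup>2)"
  then have x: "x \<in> space \<nu>" by simp
  have "integrable \<nu> (\<lambda>y. h x y * f y)"
    by (rule integrable_mult_of_nonneg_squares[OF f _ _ int])
      (use x in \<open>auto simp: rate_integrable[OF zero_less_one rate] rate_nonneg[OF zero_less_one rate]\<close>)
  then show "integrable \<nu> (\<lambda>y. h x y * f y) \<and> kernel_op P f x = jump_op 1 h f x"
    by (simp add: kernel_op_eq_jump_op[OF rate P f x])
qed

lemma L2_norm_kernel_op:
  assumes rate: "reversible_rate 1 h" and P: "represents P h"
    and f [measurable]: "f \<in> borel_measurable \<nu>" and f2: "integrable \<mu> (\<lambda>x. (f x)\<^sup>2)"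
  shows "L2_norm \<mu> (kernel_op P f) = L2_norm \<mu> (jump_op 1 h f)"
proof -
  note [measurable] = rate_measurable[OF zero_less_one rate] jump_op_measurable[OF zero_less_one rate f]
  have "kernel_op P f \<in> borel_measurable \<nu> \<longleftrightarrow>
      (\<lambda>x. if integrable \<nu> (\<lambda>y. h x y * f y) then jump_op 1 h f x else 0) \<in> borel_measurable \<nu>"
    by (intro measurable_cong kernel_op_eq_jump_op[OF rate P f])
  then have [measurable]: "kernel_op P f \<in> borel_measurable \<nu>"
    by simp
  have "(\<integral>x. (kernel_op P f x)\<^sup>2 \<partial>\<mu>) = (\<integral>x. (jump_op 1 h f x)\<^sup>2 \<partial>\<mu>)"
    using AE_kernel_op[OF rate P f f2] by (intro integral_cong_AE) auto
  then show ?thesis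
    by (simp add: L2_norm_def)
qed

text \<open>Besides the contraction property, this provides finiteness of the norm, so that the
  comparison of gaps can be done with real numbers.\<close>

lemma op_norm_L20_le_1:
  assumes rate: "reversible_rate 1 h" and P: "represents P h"
  shows "op_norm_L20 \<mu> P \<le> 1"
  unfolding op_norm_L20_def
proof (rule SUP_least)
  fix f assume "f \<in> {f \<in> L20 \<mu>. L2_norm \<mu> f = 1}"
  then have f: "f \<in> borel_measurable \<nu>" and f2: "integrable \<mu> (\<lambda>x. (f x)\<^sup>2)" and "L2_norm \<mu> f = 1"
    by (auto simp: L20_def)
  then have "L2_norm \<mu> (kernel_op P f) \<le> 1"
    using L2_norm_jump_op_le[OF zero_less_one rate f f2] by (simp add: L2_norm_kernel_op[OF rate P f f2])
  then show "ennreal (L2_norm \<mu> (kernel_op P f)) \<le> 1"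
    by (simp add: ennreal_le_1)
qed

text \<open>\<open>jump_op\<close> is linear jointly in mass and density, and
  \<open>1 = \<kappa> + (1 - \<kappa>)\<close>. Hence the norm of \<open>P\<close> is at most
  \<open>\<kappa> * s + (1 - \<kappa>)\<close> with \<open>s\<close> the norm of \<open>Q\<close>,
  and one minus this bound equals \<open>\<kappa> * (1 - s)\<close>.\<close>

lemma Gap_ge_mult_Gap:
  assumes \<kappa>: "0 < \<kappa>" "\<kappa> < 1"
    and hP: "reversible_rate 1 hP" and hQ: "reversible_rate 1 hQ"
    and hD: "reversible_rate (1 - \<kappa>) (\<lambda>x y. hP x y - \<kappa> * hQ x y)"
    and P: "represents P hP" and Q: "represents Q hQ"
  shows "ereal \<kappa> * Gap \<mu> Q \<le> Gap \<mu> P"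
proof -
  define hD where "hD x y = hP x y - \<kappa> * hQ x y" for x y
  have hD: "reversible_rate (1 - \<kappa>) hD"
    using hD by (simp add: hD_def[abs_def])
  have \<kappa>1: "0 < 1 - \<kappa>"
    using \<kappa> by simp
  note [measurable] = rate_measurable[OF zero_less_one hP] rate_measurable[OF zero_less_one hQ] rate_measurable[OF \<kappa>1 hD]
  obtain s where s: "0 \<le> s" "op_norm_L20 \<mu> Q = ennreal s"
    using op_norm_L20_le_1[OF hQ Q] by (cases "op_norm_L20 \<mu> Q") (auto simp: top_unique)
  have "op_norm_L20 \<mu> P \<le> ennreal (\<kappa> * s + (1 - \<kappa>))"
    unfolding op_norm_L20_def
  proof (rule SUP_least)
    fix f assume f_in: "f \<in> {f \<in> L20 \<mu>. L2_norm \<mu> f = 1}"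
    then have f [measurable]: "f \<in> borel_measurable \<nu>" and f2: "integrable \<mu> (\<lambda>x. (f x)\<^sup>2)" and norm_f: "L2_norm \<mu> f = 1"
      by (auto simp: L20_def)
    note [measurable] = jump_op_measurable[OF zero_less_one hP f] jump_op_measurable[OF zero_less_one hQ f]
      jump_op_measurable[OF \<kappa>1 hD f]
    \<comment> \<open>The identity is claimed almost everywhere only, because linearity of the
      integral needs both jump integrals to converge.\<close>
    have split: "AE x in \<mu>. jump_op 1 hP f x = \<kappa> * jump_op 1 hQ f x + jump_op (1 - \<kappa>) hD f x"
      using AE_kernel_op[OF hP P f f2] AE_kernel_op[OF hQ Q f f2] AE_space
    proof eventually_elim
      case (elim x)
      then have x: "x \<in> space \<nu>"
        by simp
      have "jump_mass hD x = jump_mass hP x - \<kappa> * jump_mass hQ x"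
        using rate_integrable[OF zero_less_one hP x] rate_integrable[OF zero_less_one hQ x]
        by (simp add: jump_mass_def hD_def)
      moreover have "(\<integral>y. hD x y * f y \<partial>\<nu>) = (\<integral>y. hP x y * f y \<partial>\<nu>) - \<kappa> * (\<integral>y. hQ x y * f y \<partial>\<nu>)"
      proof -
        have "(\<integral>y. hD x y * f y \<partial>\<nu>) = (\<integral>y. hP x y * f y - \<kappa> * (hQ x y * f y) \<partial>\<nu>)"
          by (simp add: hD_def left_diff_distrib mult.assoc)
        then show ?thesis
          using elim by simp
      qed
      ultimately show ?case
        by (simp only: jump_op_def) (simp add: algebra_simps)
    qed
    have "L2_norm \<mu> (kernel_op P f) = L2_norm \<mu> (\<lambda>x. \<kappa> * jump_op 1 hQ f x + jump_op (1 - \<kappa>) hD f x)"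
    proof -
      have "(\<integral>x. (jump_op 1 hP f x)\<^sup>2 \<partial>\<mu>) = (\<integral>x. (\<kappa> * jump_op 1 hQ f x + jump_op (1 - \<kappa>) hD f x)\<^sup>2 \<partial>\<mu>)"
        using split by (intro integral_cong_AE) auto
      then show ?thesis
        unfolding L2_norm_kernel_op[OF hP P f f2] by (simp add: L2_norm_def)
    qed
    also have "\<dots> \<le> L2_norm \<mu> (\<lambda>x. \<kappa> * jump_op 1 hQ f x) + L2_norm \<mu> (jump_op (1 - \<kappa>) hD f)"
      using jump_op_square_integrable[OF zero_less_one hQ f f2] jump_op_square_integrable[OF \<kappa>1 hD f f2]
      by (intro L2_norm_add_le) (auto simp: power_mult_distrib)
    also have "L2_norm \<mu> (\<lambda>x. \<kappa> * jump_op 1 hQ f x) = \<kappa> * L2_norm \<mu> (kernel_op Q f)"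
      unfolding L2_norm_kernel_op[OF hQ Q f f2] using \<kappa> by (simp add: L2_norm_def power_mult_distrib real_sqrt_mult)
    also have "\<kappa> * L2_norm \<mu> (kernel_op Q f) + L2_norm \<mu> (jump_op (1 - \<kappa>) hD f) \<le> \<kappa> * s + (1 - \<kappa>)"
    proof (intro add_mono mult_left_mono)
      have "ennreal (L2_norm \<mu> (kernel_op Q f)) \<le> op_norm_L20 \<mu> Q"
        unfolding op_norm_L20_def using f_in by (rule SUP_upper)
      then show "L2_norm \<mu> (kernel_op Q f) \<le> s"
        using s by (simp add: ennreal_le_iff)
      show "L2_norm \<mu> (jump_op (1 - \<kappa>) hD f) \<le> 1 - \<kappa>"
        using L2_norm_jump_op_le[OF \<kappa>1 hD f f2] norm_f by simp
    qed (use \<kappa> in simp)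
    finally show "ennreal (L2_norm \<mu> (kernel_op P f)) \<le> ennreal (\<kappa> * s + (1 - \<kappa>))"
      by (rule ennreal_leI)
  qed
  then have "enn2ereal (op_norm_L20 \<mu> P) \<le> enn2ereal (ennreal (\<kappa> * s + (1 - \<kappa>)))"
    by (simp only: less_eq_ennreal.rep_eq)
  also have "\<dots> = ereal (\<kappa> * s + (1 - \<kappa>))"
    using \<kappa> s(1) by (intro enn2ereal_ennreal add_nonneg_nonneg mult_nonneg_nonneg) auto
  finally have "1 - ereal (\<kappa> * s + (1 - \<kappa>)) \<le> Gap \<mu> P"
    unfolding Gap_def by (intro ereal_minus_mono order_refl)
  moreover have "ereal \<kappa> * Gap \<mu> Q = 1 - ereal (\<kappa> * s + (1 - \<kappa>))"
    unfolding Gap_def s(2) using s(1) by (simp add: enn2ereal_ennreal one_ereal_def algebra_simps)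
  ultimately show ?thesis
    by simp
qed

section \<open>Propose/accept kernels\<close>

text \<open>On a fixed set the measure is a combination of two indicators weighted by the acceptance
  and rejection probabilities, which is measurable in \<open>y\<close>. This is the side condition
  for integrating against the bind.\<close>

lemma measurable_accept_kernel:
  fixes acc :: "'a \<Rightarrow> bool pmf"
  assumes [measurable]: "(\<lambda>y. pmf (acc y) True) \<in> borel_measurable \<nu>" and x: "x \<in> space \<nu>"
  shows "(\<lambda>y. distr (measure_pmf (acc y)) \<nu> (\<lambda>b. if b then y else x)) \<in> measurable \<nu> (subprob_algebra \<nu>)"
proof (rule measurable_subprob_algebra)
  fix y assume y: "y \<in> space \<nu>"
  have m: "(\<lambda>b. if b then y else x) \<in> measurable (measure_pmf (acc y)) \<nu>"
    using x y by simp
  show "subprob_space (distr (measure_pmf (acc y)) \<nu> (\<lambda>b. if b then y else x))"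
    using m by (intro prob_space_imp_subprob_space measure_pmf.prob_space_distr)
next
  fix A assume A [measurable]: "A \<in> sets \<nu>"
  have "(\<lambda>y. emeasure (distr (measure_pmf (acc y)) \<nu> (\<lambda>b. if b then y else x)) A) \<in> borel_measurable \<nu> \<longleftrightarrow>
    (\<lambda>y. ennreal (pmf (acc y) True) * indicator A y + ennreal (1 - pmf (acc y) True) * indicator A x) \<in> borel_measurable \<nu>"
  proof (rule measurable_cong)
    fix y assume y: "y \<in> space \<nu>"
    have m: "(\<lambda>b. if b then y else x) \<in> measurable (measure_pmf (acc y)) \<nu>"
      using x y by simp
    have "emeasure (distr (measure_pmf (acc y)) \<nu> (\<lambda>b. if b then y else x)) A =
        (\<integral>\<^sup>+z. indicator A z \<partial>distr (measure_pmf (acc y)) \<nu> (\<lambda>b. if b then y else x))"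
      by simp
    also have "\<dots> = (\<integral>\<^sup>+b. indicator A (if b then y else x) \<partial>measure_pmf (acc y))"
      using m by (subst nn_integral_distr) auto
    also have "\<dots> = ennreal (pmf (acc y) True) * indicator A y + ennreal (1 - pmf (acc y) True) * indicator A x"
      by (simp only: nn_integral_bool_pmf if_True if_False)
    finally show "emeasure (distr (measure_pmf (acc y)) \<nu> (\<lambda>b. if b then y else x)) A =
      ennreal (pmf (acc y) True) * indicator A y + ennreal (1 - pmf (acc y) True) * indicator A x" .
  qed
  then show "(\<lambda>y. emeasure (distr (measure_pmf (acc y)) \<nu> (\<lambda>b. if b then y else x)) A) \<in> borel_measurable \<nu>"
    by simp
qed simp

text \<open>Accepted proposals have density \<open>q\<close> times the acceptance probability; all
  rejected ones pile up in the atom at \<open>x\<close>.\<close>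

lemma represents_propose_accept_kernel:
  fixes q :: "'a \<Rightarrow> 'a \<Rightarrow> real"
  assumes acc_measurable: "(\<lambda>(x, y). pmf (acc x y) True) \<in> borel_measurable (\<nu> \<Otimes>\<^sub>M \<nu>)"
    and q_measurable: "(\<lambda>(x, y). q x y) \<in> borel_measurable (\<nu> \<Otimes>\<^sub>M \<nu>)"
    and q_nonneg: "\<And>x y. x \<in> space \<nu> \<Longrightarrow> y \<in> space \<nu> \<Longrightarrow> 0 \<le> q x y"
    and q_markov: "\<And>x. x \<in> space \<nu> \<Longrightarrow> (\<integral>\<^sup>+y. ennreal (q x y) \<partial>\<nu>) = 1"
  shows "represents (propose_accept_kernel \<nu> q acc) (\<lambda>x y. q x y * pmf (acc x y) True)"
  unfolding represents_def
proof (intro ballI conjI)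
  fix x assume x: "x \<in> space \<nu>"
  define a where "a y = pmf (acc x y) True" for y
  have a: "0 \<le> a y" "a y \<le> 1" for y
    by (auto simp: a_def pmf_le_1)
  have [measurable]: "(\<lambda>y. pmf (acc x y) True) \<in> borel_measurable \<nu>" "(\<lambda>y. q x y) \<in> borel_measurable \<nu>"
    using measurable_compose_Pair1[OF x acc_measurable] measurable_compose_Pair1[OF x q_measurable] by simp_all
  then have [measurable]: "a \<in> borel_measurable \<nu>"
    by (simp add: a_def[abs_def])
  let ?D = "density \<nu> (\<lambda>y. ennreal (q x y))"
  let ?K = "\<lambda>y. distr (measure_pmf (acc x y)) \<nu> (\<lambda>b. if b then y else x)"
  have K: "?K \<in> measurable ?D (subprob_algebra \<nu>)"
    using measurable_accept_kernel[of "acc x", OF _ x] by simp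
  have space_D: "space ?D \<noteq> {}"
    using x by auto
  show "sets (propose_accept_kernel \<nu> q acc x) = sets \<nu>"
    unfolding propose_accept_kernel_def using K space_D by (rule sets_bind_measurable)
  \<comment> \<open>As \<open>q x\<close> has mass 1, the rejected mass is what the jumps leave
    over.\<close>
  have stay: "(\<integral>\<^sup>+y. ennreal (q x y * (1 - a y)) \<partial>\<nu>) = ennreal (1 - jump_mass (\<lambda>x y. q x y * pmf (acc x y) True) x)"
  proof -
    have q_int: "integrable \<nu> (q x)"
      using q_markov[OF x] q_nonneg[OF x] by (intro integrableI_nonneg) auto
    have q1: "(\<integral>y. q x y \<partial>\<nu>) = 1"
      using q_markov[OF x] q_nonneg[OF x] by (subst integral_eq_nn_integral) auto
    have "norm (q x y * a y) \<le> norm (q x y)" if "y \<in> space \<nu>" for y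
      using a[of y] q_nonneg[OF x that] by (simp add: abs_mult mult_left_le)
    then have qa_int: "integrable \<nu> (\<lambda>y. q x y * a y)"
      by (intro Bochner_Integration.integrable_bound[OF q_int] AE_I2) auto
    have "(\<integral>\<^sup>+y. ennreal (q x y * (1 - a y)) \<partial>\<nu>) = ennreal (\<integral>y. q x y * (1 - a y) \<partial>\<nu>)"
    proof (rule nn_integral_eq_integral)
      show "integrable \<nu> (\<lambda>y. q x y * (1 - a y))"
        using q_int qa_int by (simp add: right_diff_distrib)
      show "AE y in \<nu>. 0 \<le> q x y * (1 - a y)"
        using a q_nonneg[OF x] by (intro AE_I2 mult_nonneg_nonneg) auto
    qed
    also have "(\<integral>y. q x y * (1 - a y) \<partial>\<nu>) = 1 - (\<integral>y. q x y * a y \<partial>\<nu>)"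
      using q_int qa_int by (simp add: right_diff_distrib q1)
    finally show ?thesis
      by (simp add: jump_mass_def a_def)
  qed
  fix g :: "'a \<Rightarrow> ennreal" assume g [measurable]: "g \<in> borel_measurable \<nu>"
  have "(\<integral>\<^sup>+y. g y \<partial>propose_accept_kernel \<nu> q acc x) = (\<integral>\<^sup>+y. (\<integral>\<^sup>+z. g z \<partial>?K y) \<partial>?D)"
    unfolding propose_accept_kernel_def by (rule nn_integral_bind[OF g K])
  also have "\<dots> = (\<integral>\<^sup>+y. ennreal (a y) * g y + ennreal (1 - a y) * g x \<partial>?D)"
  proof (rule nn_integral_cong)
    fix y assume "y \<in> space ?D"
    then have y: "y \<in> space \<nu>" by simp
    have "(\<integral>\<^sup>+z. g z \<partial>?K y) = (\<integral>\<^sup>+b. g (if b then y else x) \<partial>measure_pmf (acc x y))"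
      using x y by (subst nn_integral_distr) auto
    also have "\<dots> = ennreal (a y) * g y + ennreal (1 - a y) * g x"
      by (simp only: nn_integral_bool_pmf if_True if_False a_def)
    finally show "(\<integral>\<^sup>+z. g z \<partial>?K y) = ennreal (a y) * g y + ennreal (1 - a y) * g x" .
  qed
  also have "\<dots> = (\<integral>\<^sup>+y. ennreal (q x y) * (ennreal (a y) * g y + ennreal (1 - a y) * g x) \<partial>\<nu>)"
    by (rule nn_integral_density) measurable
  also have "\<dots> = (\<integral>\<^sup>+y. ennreal (q x y * a y) * g y + ennreal (q x y * (1 - a y)) * g x \<partial>\<nu>)"
    using a q_nonneg[OF x] by (intro nn_integral_cong) (simp add: ennreal_mult distrib_left mult.assoc)
  also have "\<dots> = (\<integral>\<^sup>+y. ennreal (q x y * a y) * g y \<partial>\<nu>) + (\<integral>\<^sup>+y. ennreal (q x y * (1 - a y)) * g x \<partial>\<nu>)"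
    by (rule nn_integral_add) measurable
  also have "(\<integral>\<^sup>+y. ennreal (q x y * (1 - a y)) * g x \<partial>\<nu>) = (\<integral>\<^sup>+y. ennreal (q x y * (1 - a y)) \<partial>\<nu>) * g x"
    by (rule nn_integral_multc) measurable
  finally show "(\<integral>\<^sup>+y. g y \<partial>propose_accept_kernel \<nu> q acc x) =
    (\<integral>\<^sup>+y. ennreal (q x y * pmf (acc x y) True) * g y \<partial>\<nu>)
      + ennreal (1 - jump_mass (\<lambda>x y. q x y * pmf (acc x y) True) x) * g x"
    unfolding stay by (simp only: a_def)
qed

text \<open>The two halves of \<open>compare\<close> have different uses:
  \<open>\<kappa> \<alpha> \<le> a\<close> makes the remainder nonnegative, and
  \<open>a \<le> \<alpha>\<close> bounds it by \<open>(1 - \<kappa>) \<alpha>\<close>, hence its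
  mass by \<open>1 - \<kappa>\<close>.\<close>

lemma Gap_propose_accept_ge:
  fixes q :: "'a \<Rightarrow> 'a \<Rightarrow> real" and acc acc' :: "'a \<Rightarrow> 'a \<Rightarrow> bool pmf"
  defines "a \<equiv> \<lambda>x y. pmf (acc x y) True" and "\<alpha> \<equiv> \<lambda>x y. pmf (acc' x y) True"
  assumes \<kappa>: "0 < \<kappa>" "\<kappa> < 1"
    and q_measurable [measurable]: "(\<lambda>(x, y). q x y) \<in> borel_measurable (\<nu> \<Otimes>\<^sub>M \<nu>)"
    and q_nonneg: "\<And>x y. x \<in> space \<nu> \<Longrightarrow> y \<in> space \<nu> \<Longrightarrow> 0 \<le> q x y"
    and q_markov: "\<And>x. x \<in> space \<nu> \<Longrightarrow> (\<integral>\<^sup>+y. ennreal (q x y) \<partial>\<nu>) = 1"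
    and a_measurable [measurable]: "(\<lambda>(x, y). a x y) \<in> borel_measurable (\<nu> \<Otimes>\<^sub>M \<nu>)"
    and \<alpha>_measurable [measurable]: "(\<lambda>(x, y). \<alpha> x y) \<in> borel_measurable (\<nu> \<Otimes>\<^sub>M \<nu>)"
    and a_sym: "\<And>x y. x \<in> space \<nu> \<Longrightarrow> y \<in> space \<nu> \<Longrightarrow> w x * q x y * a x y = w y * q y x * a y x"
    and \<alpha>_sym: "\<And>x y. x \<in> space \<nu> \<Longrightarrow> y \<in> space \<nu> \<Longrightarrow> w x * q x y * \<alpha> x y = w y * q y x * \<alpha> y x"
    and compare: "\<And>x y. x \<in> space \<nu> \<Longrightarrow> y \<in> space \<nu> \<Longrightarrow> \<kappa> * \<alpha> x y \<le> a x y \<and> a x y \<le> \<alpha> x y"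
  shows "ereal \<kappa> * Gap \<mu> (propose_accept_kernel \<nu> q acc') \<le> Gap \<mu> (propose_accept_kernel \<nu> q acc)"
proof (rule Gap_ge_mult_Gap[OF \<kappa>, where hP="\<lambda>x y. q x y * a x y" and hQ="\<lambda>x y. q x y * \<alpha> x y"])
  have \<alpha>: "0 \<le> \<alpha> x y" "\<alpha> x y \<le> 1" and a: "0 \<le> a x y" "a x y \<le> 1" for x y
    by (auto simp: \<alpha>_def a_def pmf_le_1)
  \<comment> \<open>Stated for general \<open>m\<close> and \<open>b\<close>, to be used for
    \<open>a\<close> and \<open>\<alpha>\<close> with mass 1 and for their weighted difference with
    mass \<open>1 - \<kappa>\<close>.\<close>
  have rate: "reversible_rate m (\<lambda>x y. q x y * b x y)"
    if [measurable]: "(\<lambda>(x, y). b x y) \<in> borel_measurable (\<nu> \<Otimes>\<^sub>M \<nu>)"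
      and b: "\<And>x y. x \<in> space \<nu> \<Longrightarrow> y \<in> space \<nu> \<Longrightarrow> 0 \<le> b x y \<and> b x y \<le> m"
      and sym: "\<And>x y. x \<in> space \<nu> \<Longrightarrow> y \<in> space \<nu> \<Longrightarrow> w x * q x y * b x y = w y * q y x * b y x"
    for m b
    unfolding reversible_rate_def
  proof (intro conjI ballI)
    fix x assume x: "x \<in> space \<nu>"
    have "0 \<le> m"
      using b[OF x x] by linarith
    have "(\<integral>\<^sup>+y. ennreal (q x y * b x y) \<partial>\<nu>) \<le> (\<integral>\<^sup>+y. ennreal m * ennreal (q x y) \<partial>\<nu>)"
      using b[OF x] q_nonneg[OF x] \<open>0 \<le> m\<close>
      by (intro nn_integral_mono) (auto simp: ennreal_mult[symmetric] mult.commute[of m] intro!: ennreal_leI mult_left_mono)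
    also have "\<dots> = ennreal m"
      using x by (subst nn_integral_cmult) (auto simp: q_markov)
    finally show "(\<integral>\<^sup>+y. ennreal (q x y * b x y) \<partial>\<nu>) \<le> ennreal m" .
  qed (use b q_nonneg sym in \<open>auto simp: mult.assoc\<close>)
  show "reversible_rate 1 (\<lambda>x y. q x y * a x y)" "reversible_rate 1 (\<lambda>x y. q x y * \<alpha> x y)"
    using a \<alpha> a_sym \<alpha>_sym by (auto intro!: rate)
  have "reversible_rate (1 - \<kappa>) (\<lambda>x y. q x y * (a x y - \<kappa> * \<alpha> x y))"
  proof (rule rate)
    fix x y assume xy: "x \<in> space \<nu>" "y \<in> space \<nu>"
    have "a x y - \<kappa> * \<alpha> x y \<le> (1 - \<kappa>) * \<alpha> x y"
      using compare[OF xy] by (simp add: algebra_simps)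
    also have "\<dots> \<le> 1 - \<kappa>"
      using \<kappa> \<alpha>[of x y] by (intro mult_left_le) auto
    finally show "0 \<le> a x y - \<kappa> * \<alpha> x y \<and> a x y - \<kappa> * \<alpha> x y \<le> 1 - \<kappa>"
      using compare[OF xy] by simp
    show "w x * q x y * (a x y - \<kappa> * \<alpha> x y) = w y * q y x * (a y x - \<kappa> * \<alpha> y x)"
      using a_sym[OF xy] \<alpha>_sym[OF xy] by (simp add: right_diff_distrib mult.left_commute[of _ \<kappa>])
  qed measurable
  then show "reversible_rate (1 - \<kappa>) (\<lambda>x y. q x y * a x y - \<kappa> * (q x y * \<alpha> x y))"
    by (simp add: right_diff_distrib mult.left_commute)
  show "represents (propose_accept_kernel \<nu> q acc) (\<lambda>x y. q x y * a x y)"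
    unfolding a_def using a_measurable q_measurable q_nonneg q_markov
    by (intro represents_propose_accept_kernel) (auto simp: a_def)
  show "represents (propose_accept_kernel \<nu> q acc') (\<lambda>x y. q x y * \<alpha> x y)"
    unfolding \<alpha>_def using \<alpha>_measurable q_measurable q_nonneg q_markov
    by (intro represents_propose_accept_kernel) (auto simp: \<alpha>_def)
qed

end

subsection \<open>Acceptance probabilities of TunaMH\<close>

text \<open>Since \<open>0 ^ 0 = 1\<close>, a single formula covers rate 0 too; being explicit in
  the rate, it makes measurability in the states accessible.\<close>

lemma pmf_poisson0: "0 \<le> r \<Longrightarrow> pmf (poisson0_pmf r) k = r ^ k / fact k * exp (- r)"
  by (cases "k = 0") (auto simp: poisson0_pmf_def)

lemma exp_sum_of_nat_ln:
  fixes v :: "'i \<Rightarrow> real"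
  assumes I: "finite I" and v: "\<And>i. i \<in> I \<Longrightarrow> 0 < v i"
  shows "exp (\<Sum>i\<in>{i\<in>I. 0 < s i}. real (s i) * ln (v i)) = (\<Prod>i\<in>I. v i ^ s i)"
proof -
  have "(\<Sum>i\<in>{i\<in>I. 0 < s i}. real (s i) * ln (v i)) = (\<Sum>i\<in>I. real (s i) * ln (v i))"
    using I by (intro sum.mono_neutral_left) auto
  then show ?thesis
    using I v by (simp add: exp_sum exp_of_nat_mult)
qed

text \<open>Counting measure on a countable set is sigma-finite, so measurability of a partial
  integral applies. It serves for the expectation over the Poisson samples.\<close>

lemma borel_measurable_nn_integral_count_space_countable:
  fixes g :: "'a \<Rightarrow> 'b \<Rightarrow> ennreal"
  assumes T: "countable T" and g: "\<And>s. s \<in> T \<Longrightarrow> (\<lambda>x. g x s) \<in> borel_measurable M"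
  shows "(\<lambda>x. \<integral>\<^sup>+s. g x s \<partial>count_space T) \<in> borel_measurable M"
proof -
  interpret sigma_finite_measure "count_space T"
    by (rule sigma_finite_measure_count_space_countable[OF T])
  have "(\<lambda>(s, x). g x s) \<in> borel_measurable (count_space T \<Otimes>\<^sub>M M)"
    using T g by (intro measurable_pair_measure_countable1) auto
  from measurable_pair_swap[OF this] have "(\<lambda>(x, s). g x s) \<in> borel_measurable (M \<Otimes>\<^sub>M count_space T)"
    by simp
  then show ?thesis
    by (rule borel_measurable_nn_integral)
qed

locale tuna_mh =
  fixes \<nu> :: "'a measure"
    and U :: "nat \<Rightarrow> 'a \<Rightarrow> real"
    and N :: nat
    and c :: "nat \<Rightarrow> real"
    and M :: "'a \<Rightarrow> 'a \<Rightarrow> real"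
    and q :: "'a \<Rightarrow> 'a \<Rightarrow> real"
    and chi :: real
  assumes U_measurable: "\<And>i. i \<in> {1..N} \<Longrightarrow> U i \<in> borel_measurable \<nu>"
    and normalizable: "integrable \<nu> (\<lambda>\<theta>. exp (- (\<Sum>i=1..N. U i \<theta>)))"
      "(\<integral>\<theta>. exp (- (\<Sum>i=1..N. U i \<theta>)) \<partial>\<nu>) > 0"
    and c_pos: "\<And>i. i \<in> {1..N} \<Longrightarrow> c i > 0"
    and M_measurable: "(\<lambda>(\<theta>, \<theta>'). M \<theta> \<theta>') \<in> borel_measurable (\<nu> \<Otimes>\<^sub>M \<nu>)"
    and M_sym: "\<And>\<theta> \<theta>'. \<theta> \<in> space \<nu> \<Longrightarrow> \<theta>' \<in> space \<nu> \<Longrightarrow> M \<theta> \<theta>' = M \<theta>' \<theta>"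
    and U_bound: "\<And>i \<theta> \<theta>'. i \<in> {1..N} \<Longrightarrow> \<theta> \<in> space \<nu> \<Longrightarrow> \<theta>' \<in> space \<nu> \<Longrightarrow>
      \<bar>U i \<theta>' - U i \<theta>\<bar> \<le> c i * M \<theta> \<theta>'"
    and q_measurable: "(\<lambda>(\<theta>, \<theta>'). q \<theta> \<theta>') \<in> borel_measurable (\<nu> \<Otimes>\<^sub>M \<nu>)"
    and q_nonneg: "\<And>\<theta> \<theta>'. \<theta> \<in> space \<nu> \<Longrightarrow> \<theta>' \<in> space \<nu> \<Longrightarrow> q \<theta> \<theta>' \<ge> 0"
    and q_markov: "\<And>\<theta>. \<theta> \<in> space \<nu> \<Longrightarrow> (\<integral>\<^sup>+\<theta>'. ennreal (q \<theta> \<theta>') \<partial>\<nu>) = 1"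
    and chi_pos: "chi > 0"
begin

abbreviation "w \<equiv> target_density \<nu> U N"
abbreviation "C \<equiv> \<Sum>i=1..N. c i"
abbreviation "lam \<equiv> tuna_lambda c M N chi"
abbreviation "phi \<equiv> tuna_phi U c M"

definition poisson_rate :: "'a \<Rightarrow> 'a \<Rightarrow> nat \<Rightarrow> real" where
  "poisson_rate x y i = lam x y * c i / C + phi i x y"

definition mh_ratio :: "'a \<Rightarrow> 'a \<Rightarrow> real" where
  "mh_ratio x y = (w y * q y x) / (w x * q x y)"

definition accept_prob :: "'a \<Rightarrow> 'a \<Rightarrow> real" where
  "accept_prob x y = pmf (tuna_accept U c M N chi q x y) True"

sublocale positive_density \<nu> w
proof -
  have [measurable]: "(\<lambda>x. \<Sum>i=1..N. U i x) \<in> borel_measurable \<nu>"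
    using U_measurable by (intro borel_measurable_sum) auto
  have "sigma_finite_measure \<nu>"
    using normalizable(1) by (rule sigma_finite_measure_of_pos_integrable) simp
  moreover have "w \<in> borel_measurable \<nu>"
    unfolding target_density_def[abs_def] by measurable
  moreover have "0 < w x" for x
    using normalizable(2) by (simp add: target_density_def)
  ultimately show "positive_density \<nu> w"
    by (simp add: positive_density_def positive_density_axioms_def)
qed

lemma target_eq: "target \<nu> U N = \<mu>"
  by (simp add: target_def \<mu>_def)

lemma mh_ratio_nonneg: "x \<in> space \<nu> \<Longrightarrow> y \<in> space \<nu> \<Longrightarrow> 0 \<le> mh_ratio x y"
  unfolding mh_ratio_def by (intro divide_nonneg_nonneg mult_nonneg_nonneg less_imp_le[OF w_pos] q_nonneg)

lemma pmf_ideal_accept: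
  "x \<in> space \<nu> \<Longrightarrow> y \<in> space \<nu> \<Longrightarrow> pmf (ideal_accept \<nu> U N q x y) True = min 1 (mh_ratio x y)"
  using mh_ratio_nonneg[of x y] by (simp add: ideal_accept_def mh_ratio_def)

lemma tuna_ratio_nonneg:
  "x \<in> space \<nu> \<Longrightarrow> y \<in> space \<nu> \<Longrightarrow> 0 \<le> tuna_ratio U c M N chi q x y s"
  unfolding tuna_ratio_def Let_def by (intro mult_nonneg_nonneg divide_nonneg_nonneg q_nonneg) auto

lemma ennreal_accept_prob:
  assumes "x \<in> space \<nu>" "y \<in> space \<nu>"
  shows "ennreal (accept_prob x y) =
    (\<integral>\<^sup>+s. ennreal (min 1 (tuna_ratio U c M N chi q x y s)) \<partial>measure_pmf (tuna_samples U c M N chi x y))"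
  unfolding accept_prob_def tuna_accept_def ennreal_pmf_bind
  using tuna_ratio_nonneg[OF assms] by (intro nn_integral_cong) simp

lemma accept_prob_eq:
  assumes "x \<in> space \<nu>" "y \<in> space \<nu>"
  shows "accept_prob x y =
    (\<integral>s. min 1 (tuna_ratio U c M N chi q x y s) \<partial>measure_pmf (tuna_samples U c M N chi x y))"
  unfolding accept_prob_def tuna_accept_def pmf_bind
  using tuna_ratio_nonneg[OF assms] by (intro Bochner_Integration.integral_cong) simp_all

lemma C_nonneg: "0 \<le> C"
  using c_pos by (intro sum_nonneg) (auto intro: less_imp_le)

lemma phi_nonneg:
  assumes "i \<in> {1..N}" "x \<in> space \<nu>" "y \<in> space \<nu>"
  shows "0 \<le> phi i x y"
  using U_bound[OF assms] by (simp add: tuna_phi_def field_simps abs_le_iff)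

lemma phi_diff:
  assumes "x \<in> space \<nu>" "y \<in> space \<nu>"
  shows "phi i y x - phi i x y = U i x - U i y"
  using M_sym[OF assms] by (simp add: tuna_phi_def field_simps)

lemma lam_sym: "x \<in> space \<nu> \<Longrightarrow> y \<in> space \<nu> \<Longrightarrow> lam y x = lam x y"
  using M_sym[of x y] by (simp add: tuna_lambda_def)

text \<open>The parts of the rates built from \<open>lam\<close> and \<open>M\<close> are symmetric
  and cancel. This ties the exponential factors of the Poisson laws to the energy differences in the
  target ratio.\<close>

lemma poisson_rate_diff:
  assumes "x \<in> space \<nu>" "y \<in> space \<nu>"
  shows "poisson_rate y x i - poisson_rate x y i = U i x - U i y"
  using phi_diff[OF assms, of i] lam_sym[OF assms] by (simp add: poisson_rate_def)

lemma poisson_rate_ge: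
  assumes "i \<in> {1..N}" "x \<in> space \<nu>" "y \<in> space \<nu>"
  shows "lam x y * c i / C \<le> poisson_rate x y i" "lam x y * c i / C \<le> poisson_rate y x i"
  using phi_nonneg[OF assms] phi_nonneg[OF assms(1,3,2)] lam_sym[OF assms(2,3)] by (simp_all add: poisson_rate_def)

lemma poisson_rate_nonneg:
  assumes "i \<in> {1..N}" "x \<in> space \<nu>" "y \<in> space \<nu>"
  shows "0 \<le> poisson_rate x y i"
proof -
  have "0 \<le> lam x y * c i / C"
    using C_nonneg c_pos[OF assms(1)] chi_pos by (simp add: tuna_lambda_def)
  then show ?thesis
    using poisson_rate_ge(1)[OF assms] by linarith
qed

lemma w_ratio: "w y / w x = exp (\<Sum>i=1..N. U i x - U i y)"
proof -
  have "w y / w x = exp (- (\<Sum>i=1..N. U i y)) / exp (- (\<Sum>i=1..N. U i x))"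
    using normalizable(2) by (simp add: target_density_def)
  then show ?thesis
    by (simp add: exp_diff[symmetric] sum_subtractf)
qed

lemma mh_ratio_eq: "mh_ratio x y = exp (\<Sum>i=1..N. U i x - U i y) * (q y x / q x y)"
  unfolding w_ratio[symmetric] by (simp add: mh_ratio_def)

text \<open>\<open>M x y = 0\<close> forces equal energies and zero rates, so every sample is 0; for
  \<open>N = 0\<close> all sums are empty. Either way the auxiliary variables carry no randomness.
  Separating this case leaves positive rates, where likelihood ratios make sense.\<close>

lemma accept_prob_degenerate:
  assumes xy: "x \<in> space \<nu>" "y \<in> space \<nu>" and deg: "N = 0 \<or> M x y = 0"
  shows "accept_prob x y = min 1 (mh_ratio x y)"
proof -
  have "U i y = U i x \<and> poisson_rate x y i = 0" if "i \<in> {1..N}" for i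
    using U_bound[OF that xy] deg that by (auto simp: poisson_rate_def tuna_phi_def tuna_lambda_def)
  note eq = this
  then have "tuna_samples U c M N chi x y = Pi_pmf {1..N} 0 (\<lambda>i. return_pmf 0)"
    unfolding tuna_samples_def poisson_rate_def[symmetric] by (intro Pi_pmf_cong) (auto simp: poisson0_pmf_def)
  also have "\<dots> = return_pmf (\<lambda>_. 0)"
    by simp
  finally have "accept_prob x y = min 1 (tuna_ratio U c M N chi q x y (\<lambda>_. 0))"
    by (simp add: accept_prob_eq[OF xy])
  also have "tuna_ratio U c M N chi q x y (\<lambda>_. 0) = mh_ratio x y"
    using eq by (simp add: tuna_ratio_def mh_ratio_eq Let_def)
  finally show ?thesis .
qed

section \<open>Pairs of states with positive Poisson rates\<close>

context
  fixes x y
  assumes xy: "x \<in> space \<nu>" "y \<in> space \<nu>" and nondeg: "0 < N" "M x y \<noteq> 0"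
begin

lemma C_pos: "0 < C"
  using nondeg c_pos by (intro sum_pos) auto

lemma lam_pos: "0 < lam x y"
  using C_pos chi_pos nondeg by (simp add: tuna_lambda_def)

lemma base_rate_pos: "i \<in> {1..N} \<Longrightarrow> 0 < lam x y * c i / C"
  using C_pos lam_pos c_pos by simp

lemma poisson_rate_pos:
  assumes "i \<in> {1..N}"
  shows "0 < poisson_rate x y i" "0 < poisson_rate y x i"
  using base_rate_pos[OF assms] poisson_rate_ge[OF assms xy] by linarith+

lemma tuna_samples_eq: "tuna_samples U c M N chi x y = Pi_pmf {1..N} 0 (\<lambda>i. poisson_pmf (poisson_rate x y i))"
  unfolding tuna_samples_def poisson_rate_def[symmetric]
  using poisson_rate_pos(1) by (intro Pi_pmf_cong) (auto simp: poisson0_pmf_def less_imp_neq[THEN not_sym])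

text \<open>With \<open>m i\<close> the base rate \<open>lam x y * c i / C\<close>, each argument of
  \<open>ln\<close> is a Poisson rate divided by \<open>m i\<close>, and \<open>m i\<close> cancels
  in the quotient. What remains are the powers in the likelihood ratio; its missing exponential
  factor is the inverse of the target ratio, by \<open>poisson_rate_diff\<close>.\<close>

lemma tuna_ratio_eq: "tuna_ratio U c M N chi q x y s = mh_ratio x y * poisson_lr {1..N} (poisson_rate x y) (poisson_rate y x) s"
proof -
  define m where "m i = lam x y * c i / C" for i
  have m: "0 < m i" if "i \<in> {1..N}" for i
    using base_rate_pos[OF that] by (simp add: m_def)
  have v: "1 + C / (lam x y * c i) * phi i x y = poisson_rate x y i / m i"
    "1 + C / (lam x y * c i) * phi i y x = poisson_rate y x i / m i" if "i \<in> {1..N}" for i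
  proof -
    have "1 + C / (lam x y * c i) * t = (m i + t) / m i" for t
    proof -
      have "C / (lam x y * c i) * t = t / m i"
        by (simp add: m_def)
      then show ?thesis
        using m[OF that] by (simp add: add_divide_distrib)
    qed
    then show "1 + C / (lam x y * c i) * phi i x y = poisson_rate x y i / m i"
      "1 + C / (lam x y * c i) * phi i y x = poisson_rate y x i / m i"
      by (simp_all only: poisson_rate_def lam_sym[OF xy] m_def)
  qed
  have e: "exp (\<Sum>i\<in>{i\<in>{1..N}. 0 < s i}. real (s i) * ln (1 + C / (lam x y * c i) * phi i x y)) =
      (\<Prod>i=1..N. (poisson_rate x y i / m i) ^ s i)"
    "exp (\<Sum>i\<in>{i\<in>{1..N}. 0 < s i}. real (s i) * ln (1 + C / (lam x y * c i) * phi i y x)) =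
      (\<Prod>i=1..N. (poisson_rate y x i / m i) ^ s i)"
  proof -
    have powers: "exp (\<Sum>i\<in>{i\<in>{1..N}. 0 < s i}. real (s i) * ln (g i)) = (\<Prod>i=1..N. (r i / m i) ^ s i)"
      if "\<And>i. i \<in> {1..N} \<Longrightarrow> g i = r i / m i" "\<And>i. i \<in> {1..N} \<Longrightarrow> 0 < r i" for g r :: "nat \<Rightarrow> real"
    proof -
      have "0 < g i" if "i \<in> {1..N}" for i
        using \<open>\<And>i. i \<in> {1..N} \<Longrightarrow> g i = r i / m i\<close>[OF that] \<open>\<And>i. i \<in> {1..N} \<Longrightarrow> 0 < r i\<close>[OF that] m[OF that]
        by simp
      then have "exp (\<Sum>i\<in>{i\<in>{1..N}. 0 < s i}. real (s i) * ln (g i)) = (\<Prod>i=1..N. g i ^ s i)"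
        by (intro exp_sum_of_nat_ln) auto
      also have "\<dots> = (\<Prod>i=1..N. (r i / m i) ^ s i)"
        using that(1) by (intro prod.cong refl) (simp only:)
      finally show ?thesis .
    qed
    show
      "exp (\<Sum>i\<in>{i\<in>{1..N}. 0 < s i}. real (s i) * ln (1 + C / (lam x y * c i) * phi i x y)) =
        (\<Prod>i=1..N. (poisson_rate x y i / m i) ^ s i)"
      "exp (\<Sum>i\<in>{i\<in>{1..N}. 0 < s i}. real (s i) * ln (1 + C / (lam x y * c i) * phi i y x)) =
        (\<Prod>i=1..N. (poisson_rate y x i / m i) ^ s i)"
      by (rule powers[OF v(1) poisson_rate_pos(1)] powers[OF v(2) poisson_rate_pos(2)], assumption+)+
  qed
  have "tuna_ratio U c M N chi q x y s =
      (\<Prod>i=1..N. (poisson_rate y x i / m i) ^ s i) / (\<Prod>i=1..N. (poisson_rate x y i / m i) ^ s i) * (q y x / q x y)"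
    unfolding tuna_ratio_def Let_def e ..
  also have "(\<Prod>i=1..N. (poisson_rate y x i / m i) ^ s i) / (\<Prod>i=1..N. (poisson_rate x y i / m i) ^ s i) =
      (\<Prod>i=1..N. (poisson_rate y x i / poisson_rate x y i) ^ s i)"
    unfolding prod_dividef[symmetric] using m poisson_rate_pos
    by (intro prod.cong refl) (simp add: power_divide[symmetric] less_imp_neq[THEN not_sym])
  also have "\<dots> = exp (\<Sum>i=1..N. U i x - U i y) * poisson_lr {1..N} (poisson_rate x y) (poisson_rate y x) s"
  proof -
    have "exp (\<Sum>i=1..N. U i x - U i y) * poisson_lr {1..N} (poisson_rate x y) (poisson_rate y x) s =
      (\<Prod>i=1..N. exp (poisson_rate y x i - poisson_rate x y i) * (exp (poisson_rate x y i - poisson_rate y x i) * (poisson_rate y x i / poisson_rate x y i) ^ s i))"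
      by (simp only: poisson_lr_def exp_sum[OF finite_atLeastAtMost] prod.distrib[symmetric] poisson_rate_diff[OF xy])
    also have "\<dots> = (\<Prod>i=1..N. (poisson_rate y x i / poisson_rate x y i) ^ s i)"
      by (simp only: mult.assoc[symmetric] exp_add[symmetric]) simp
    finally show ?thesis by simp
  qed
  finally show ?thesis
    by (simp add: mh_ratio_eq)
qed

lemma accept_prob_poisson: "accept_prob x y =
    (\<integral>s. min 1 (mh_ratio x y * poisson_lr {1..N} (poisson_rate x y) (poisson_rate y x) s)
      \<partial>measure_pmf (Pi_pmf {1..N} 0 (\<lambda>i. poisson_pmf (poisson_rate x y i))))"
  by (simp only: accept_prob_eq[OF xy] tuna_samples_eq tuna_ratio_eq)

lemma poisson_lr_rates_pos: "0 < poisson_lr {1..N} (poisson_rate x y) (poisson_rate y x) s"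
  by (rule poisson_lr_pos) (auto intro: poisson_rate_pos)

text \<open>The truncated ratio is at most \<open>mh_ratio x y\<close> times the likelihood ratio,
  which has mean 1.\<close>

lemma accept_prob_le_nondeg: "accept_prob x y \<le> min 1 (mh_ratio x y)"
proof (rule min.boundedI)
  show "accept_prob x y \<le> 1"
    by (simp add: accept_prob_def pmf_le_1)
  let ?p = "Pi_pmf {1..N} 0 (\<lambda>i. poisson_pmf (poisson_rate x y i))"
  have R: "has_bochner_integral (measure_pmf ?p) (poisson_lr {1..N} (poisson_rate x y) (poisson_rate y x)) 1"
    using poisson_rate_pos by (intro poisson_lr_mean) auto
  have "accept_prob x y \<le> (\<integral>s. mh_ratio x y * poisson_lr {1..N} (poisson_rate x y) (poisson_rate y x) s \<partial>measure_pmf ?p)"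
    unfolding accept_prob_poisson
    by (intro integral_mono integrable_min_one)
      (use R mh_ratio_nonneg[OF xy] poisson_lr_rates_pos in \<open>auto simp: has_bochner_integral_iff less_imp_le\<close>)
  then show "accept_prob x y \<le> mh_ratio x y"
    using R by (simp add: has_bochner_integral_iff)
qed

text \<open>The rates differ by at most \<open>c i * M x y\<close>, while the base rate is
  \<open>chi * C * c i\<close> times the square of \<open>M x y\<close>. So term \<open>i\<close> is
  at most \<open>c i / C\<close> times \<open>1 / (2 * chi)\<close>, and the weights
  \<open>c i / C\<close> sum to 1.\<close>

lemma divergence_le:
  "(\<Sum>i=1..N. (poisson_rate x y i - poisson_rate y x i)\<^sup>2 / (2 * (lam x y * c i / C))) \<le> 1 / (2 * chi)"
proof -
  have "(poisson_rate x y i - poisson_rate y x i)\<^sup>2 / (2 * (lam x y * c i / C)) \<le> c i / C * (1 / (2 * chi))"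
    if i: "i \<in> {1..N}" for i
  proof -
    have "\<bar>poisson_rate x y i - poisson_rate y x i\<bar> \<le> c i * M x y"
      using U_bound[OF i xy] poisson_rate_diff[OF xy, of i] by linarith
    then have "(poisson_rate x y i - poisson_rate y x i)\<^sup>2 \<le> (c i * M x y)\<^sup>2"
      using power_mono[of "\<bar>poisson_rate x y i - poisson_rate y x i\<bar>" "c i * M x y" 2] by simp
    then have "(poisson_rate x y i - poisson_rate y x i)\<^sup>2 / (2 * (lam x y * c i / C)) \<le> (c i * M x y)\<^sup>2 / (2 * (lam x y * c i / C))"
      using base_rate_pos[OF i] by (intro divide_right_mono) auto
    also have "\<dots> = c i / C * (1 / (2 * chi))"
      using C_pos c_pos[OF i] nondeg chi_pos unfolding tuna_lambda_def
      by (simp add: field_simps power2_eq_square)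
    finally show ?thesis .
  qed
  then have "(\<Sum>i=1..N. (poisson_rate x y i - poisson_rate y x i)\<^sup>2 / (2 * (lam x y * c i / C))) \<le>
      (\<Sum>i=1..N. c i / C * (1 / (2 * chi)))"
    by (rule sum_mono)
  also have "\<dots> = (\<Sum>i=1..N. c i) / C * (1 / (2 * chi))"
    by (simp only: sum_distrib_right[symmetric] sum_divide_distrib[symmetric])
  also have "\<dots> = 1 / (2 * chi)"
    using C_pos by simp
  finally show ?thesis .
qed

text \<open>For nonnegative numbers \<open>min 1 (\<rho> * R) \<ge> min 1 \<rho> * min 1 R\<close>;
  this splits off the ideal acceptance probability and leaves the expectation bounded by the
  relative entropy.\<close>

lemma accept_prob_ge_nondeg:
  "exp (- (1 / exp 1)) * exp (- (1 / (2 * chi))) * min 1 (mh_ratio x y) \<le> accept_prob x y"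
proof -
  let ?p = "Pi_pmf {1..N} 0 (\<lambda>i. poisson_pmf (poisson_rate x y i))"
  let ?R = "poisson_lr {1..N} (poisson_rate x y) (poisson_rate y x)"
  have "exp (- (1 / exp 1)) * exp (- (1 / (2 * chi))) \<le>
      exp (- (1 / exp 1) - (\<Sum>i=1..N. (poisson_rate x y i - poisson_rate y x i)\<^sup>2 / (2 * (lam x y * c i / C))))"
    unfolding exp_add[symmetric] using divergence_le by simp
  also have "\<dots> \<le> (\<integral>s. min 1 (?R s) \<partial>measure_pmf ?p)"
    by (intro expectation_min_poisson_lr_ge conjI base_rate_pos poisson_rate_ge xy) auto
  finally have "min 1 (mh_ratio x y) * (exp (- (1 / exp 1)) * exp (- (1 / (2 * chi)))) \<le>
      min 1 (mh_ratio x y) * (\<integral>s. min 1 (?R s) \<partial>measure_pmf ?p)"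
    using mh_ratio_nonneg[OF xy] by (intro mult_left_mono) auto
  also have "\<dots> = (\<integral>s. min 1 (mh_ratio x y) * min 1 (?R s) \<partial>measure_pmf ?p)"
    by simp
  also have "\<dots> \<le> accept_prob x y"
    unfolding accept_prob_poisson
  proof (intro integral_mono integrable_min_one integrable_mult_right)
    fix s
    show R: "0 \<le> ?R s"
      by (rule less_imp_le[OF poisson_lr_rates_pos])
    show "0 \<le> mh_ratio x y * ?R s"
      using R mh_ratio_nonneg[OF xy] by simp
    have "min 1 (mh_ratio x y) * min 1 (?R s) \<le> 1 * 1"
      using R mh_ratio_nonneg[OF xy] by (intro mult_mono) auto
    moreover have "min 1 (mh_ratio x y) * min 1 (?R s) \<le> mh_ratio x y * ?R s"
      using R mh_ratio_nonneg[OF xy] by (intro mult_mono) auto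
    ultimately show "min 1 (mh_ratio x y) * min 1 (?R s) \<le> min 1 (mh_ratio x y * ?R s)"
      by simp
  qed
  finally show ?thesis
    by (simp add: mult.commute)
qed

end

section \<open>Comparison and detailed balance of the acceptance probabilities\<close>

lemma accept_prob_compare:
  assumes xy: "x \<in> space \<nu>" "y \<in> space \<nu>"
  shows "exp (- (1 / exp 1)) * exp (- (1 / (2 * chi))) * min 1 (mh_ratio x y) \<le> accept_prob x y"
    and "accept_prob x y \<le> min 1 (mh_ratio x y)"
proof -
  have "exp (- (1 / exp 1)) * exp (- (1 / (2 * chi))) * min 1 (mh_ratio x y) \<le> 1 * min 1 (mh_ratio x y)"
    using mh_ratio_nonneg[OF xy] chi_pos by (intro mult_right_mono mult_le_one) auto
  then show "exp (- (1 / exp 1)) * exp (- (1 / (2 * chi))) * min 1 (mh_ratio x y) \<le> accept_prob x y"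
    and "accept_prob x y \<le> min 1 (mh_ratio x y)"
    using accept_prob_degenerate[OF xy] accept_prob_ge_nondeg[OF xy] accept_prob_le_nondeg[OF xy]
    by (cases "N = 0 \<or> M x y = 0"; simp)+
qed

text \<open>Both sides equal the minimum of the two flows \<open>w x * q x y\<close> and
  \<open>w y * q y x\<close>; this also holds where a proposal density is 0.\<close>

lemma mh_ratio_sym:
  assumes xy: "x \<in> space \<nu>" "y \<in> space \<nu>"
  shows "w x * q x y * min 1 (mh_ratio x y) = w y * q y x * min 1 (mh_ratio y x)"
proof -
  have "w x * q x y * min 1 (mh_ratio x y) = min (w x * q x y) (w y * q y x)"
    if "x \<in> space \<nu>" "y \<in> space \<nu>" for x y
  proof (cases "q x y = 0")
    case True
    then show ?thesis
      using w_pos[OF that(2)] q_nonneg[OF that(2,1)] by simp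
  next
    case False
    then have "0 < w x * q x y"
      using w_pos[OF that(1)] q_nonneg[OF that] by simp
    then have "w x * q x y * mh_ratio x y = w y * q y x"
      by (auto simp: mh_ratio_def)
    then show ?thesis
      using \<open>0 < w x * q x y\<close> by (simp add: min_mult_distrib_left)
  qed
  from this[OF xy] this[OF xy(2,1)] show ?thesis
    by (simp add: min.commute)
qed

text \<open>For positive flows this is \<open>expectation_min_poisson_lr_swap\<close> with
  \<open>X = w x * q x y\<close> and \<open>X' = w y * q y x\<close>, the second law being that of
  the reversed move.\<close>

lemma accept_prob_sym:
  assumes xy: "x \<in> space \<nu>" "y \<in> space \<nu>"
  shows "w x * q x y * accept_prob x y = w y * q y x * accept_prob y x"
proof -
  consider "N = 0 \<or> M x y = 0" | "0 < N" "M x y \<noteq> 0" "q x y = 0 \<or> q y x = 0"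
    | "0 < N" "M x y \<noteq> 0" "q x y \<noteq> 0" "q y x \<noteq> 0"
    by auto
  then show ?thesis
  proof cases
    case 1
    then show ?thesis
      using M_sym[OF xy] mh_ratio_sym[OF xy] accept_prob_degenerate[OF xy] accept_prob_degenerate[OF xy(2,1)] by simp
  next
    case 2
    \<comment> \<open>One ratio has numerator 0, and the other is a division by 0, which has value
      0.\<close>
    then have "mh_ratio x y = 0" "mh_ratio y x = 0"
      by (auto simp: mh_ratio_def)
    then have "accept_prob x y = 0" "accept_prob y x = 0"
      using accept_prob_compare(2)[OF xy] accept_prob_compare(2)[OF xy(2,1)] pmf_nonneg
      by (auto simp: accept_prob_def antisym)
    then show ?thesis by simp
  next
    case 3
    have "M y x \<noteq> 0"
      using 3 M_sym[OF xy] by simp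
    moreover have "0 < w x * q x y" "0 < w y * q y x"
      using 3 w_pos[OF xy(1)] w_pos[OF xy(2)] q_nonneg[OF xy] q_nonneg[OF xy(2,1)] by auto
    ultimately show ?thesis
      unfolding accept_prob_poisson[OF xy 3(1,2)] accept_prob_poisson[OF xy(2,1) 3(1) \<open>M y x \<noteq> 0\<close>] mh_ratio_def
      using poisson_rate_pos[OF xy 3(1,2)] by (intro expectation_min_poisson_lr_swap) auto
  qed
qed

section \<open>Joint measurability of the acceptance probabilities\<close>

lemma mh_ratio_measurable: "(\<lambda>(x, y). mh_ratio x y) \<in> borel_measurable (\<nu> \<Otimes>\<^sub>M \<nu>)"
proof -
  note [measurable] = q_measurable measurable_pair_swap[OF q_measurable, simplified]
  show ?thesis
    unfolding mh_ratio_def by measurable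
qed

text \<open>The expectation is a sum over a countable set \<open>T\<close> of sample vectors that
  does not depend on the states, and every summand is explicit in \<open>U\<close>, \<open>M\<close>
  and \<open>q\<close>.\<close>

lemma accept_prob_measurable: "(\<lambda>(x, y). accept_prob x y) \<in> borel_measurable (\<nu> \<Otimes>\<^sub>M \<nu>)"
proof -
  define T :: "(nat \<Rightarrow> nat) set" where "T = PiE_dflt {1..N} 0 (\<lambda>_. UNIV)"
  \<comment> \<open>The support of a pmf is countable; the rate 1 is an arbitrary positive choice
    that makes the support all of \<open>T\<close>.\<close>
  have "T = set_pmf (Pi_pmf {1..N} 0 (\<lambda>_. poisson_pmf 1))"
    by (simp add: T_def set_Pi_pmf)
  then have T: "countable T"
    by simp
  have [measurable]: "(\<lambda>z. U i (fst z)) \<in> borel_measurable (\<nu> \<Otimes>\<^sub>M \<nu>)"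
    "(\<lambda>z. U i (snd z)) \<in> borel_measurable (\<nu> \<Otimes>\<^sub>M \<nu>)" if "i \<in> {1..N}" for i
    using U_measurable[OF that] by measurable
  note [measurable] = q_measurable measurable_pair_swap[OF q_measurable, simplified]
    M_measurable measurable_pair_swap[OF M_measurable, simplified]
  have phi_m [measurable]: "(\<lambda>z. phi i (fst z) (snd z)) \<in> borel_measurable (\<nu> \<Otimes>\<^sub>M \<nu>)"
    "(\<lambda>z. phi i (snd z) (fst z)) \<in> borel_measurable (\<nu> \<Otimes>\<^sub>M \<nu>)" if "i \<in> {1..N}" for i
    using that unfolding tuna_phi_def by measurable
  have lam_m [measurable]: "(\<lambda>z. lam (fst z) (snd z)) \<in> borel_measurable (\<nu> \<Otimes>\<^sub>M \<nu>)"
    unfolding tuna_lambda_def by measurable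
  define G where "G z s = ennreal (\<Prod>i\<in>{1..N}. poisson_rate (fst z) (snd z) i ^ s i / fact (s i) * exp (- poisson_rate (fst z) (snd z) i)) *
    ennreal (min 1 (tuna_ratio U c M N chi q (fst z) (snd z) s))" for z s
  have G_m: "(\<lambda>z. G z s) \<in> borel_measurable (\<nu> \<Otimes>\<^sub>M \<nu>)" for s
    unfolding G_def poisson_rate_def tuna_ratio_def Let_def
    by (intro borel_measurable_times_ennreal measurable_compose[OF _ measurable_ennreal] borel_measurable_min
        borel_measurable_times borel_measurable_divide borel_measurable_prod borel_measurable_sum
        borel_measurable_exp borel_measurable_ln borel_measurable_add borel_measurable_power
        borel_measurable_uminus borel_measurable_const phi_m lam_m) auto
  have "(\<lambda>z. enn2real (\<integral>\<^sup>+s. G z s \<partial>count_space T)) \<in> borel_measurable (\<nu> \<Otimes>\<^sub>M \<nu>)"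
    using borel_measurable_nn_integral_count_space_countable[OF T G_m] by measurable
  moreover have "accept_prob (fst z) (snd z) = enn2real (\<integral>\<^sup>+s. G z s \<partial>count_space T)"
    if "z \<in> space (\<nu> \<Otimes>\<^sub>M \<nu>)" for z
  proof -
    define p where "p = tuna_samples U c M N chi (fst z) (snd z)"
    from that have xy: "fst z \<in> space \<nu>" "snd z \<in> space \<nu>"
      by (auto simp: space_pair_measure)
    have pmf_p: "pmf p s = (\<Prod>i\<in>{1..N}. poisson_rate (fst z) (snd z) i ^ s i / fact (s i) * exp (- poisson_rate (fst z) (snd z) i))"
      if "s \<in> T" for s
      using that unfolding p_def tuna_samples_def poisson_rate_def[symmetric]
      by (subst pmf_Pi') (auto simp: T_def PiE_dflt_def pmf_poisson0 poisson_rate_nonneg[OF _ xy])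
    have pmf_p0: "pmf p s = 0" if "s \<notin> T" for s
      using that unfolding p_def tuna_samples_def
      by (intro pmf_Pi_outside) (auto simp: T_def PiE_dflt_def)
    have "ennreal (accept_prob (fst z) (snd z)) =
        (\<integral>\<^sup>+s. ennreal (pmf p s) * ennreal (min 1 (tuna_ratio U c M N chi q (fst z) (snd z) s)) \<partial>count_space UNIV)"
      by (simp add: ennreal_accept_prob[OF xy] nn_integral_measure_pmf p_def)
    also have "\<dots> = (\<integral>\<^sup>+s. ennreal (pmf p s) * ennreal (min 1 (tuna_ratio U c M N chi q (fst z) (snd z) s)) \<partial>count_space T)"
      by (rule nn_integral_count_space_eq) (auto simp: pmf_p0)
    also have "\<dots> = (\<integral>\<^sup>+s. G z s \<partial>count_space T)"
      by (intro nn_integral_cong) (simp add: G_def pmf_p)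
    finally show ?thesis
      by (metis accept_prob_def enn2real_ennreal pmf_nonneg)
  qed
  ultimately show ?thesis
    by (subst measurable_cong[where g="\<lambda>z. enn2real (\<integral>\<^sup>+s. G z s \<partial>count_space T)"]) (auto simp: case_prod_beta)
qed

section \<open>The bound on the gap of TunaMH\<close>

lemma Gap_P_aux_ge:
  "ereal (exp (- (1 / exp 1)) * exp (- (1 / (2 * chi)))) * Gap (target \<nu> U N) (P_ideal \<nu> U N q)
    \<le> Gap (target \<nu> U N) (P_aux \<nu> U c M N chi q)"
  unfolding target_eq P_ideal_def P_aux_def
proof (rule Gap_propose_accept_ge)
  let ?\<kappa> = "exp (- (1 / exp 1)) * exp (- (1 / (2 * chi)))"
  show "0 < ?\<kappa>" by simp
  have "0 < 1 / exp (1::real)" "0 < 1 / (2 * chi)"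
    using chi_pos by simp_all
  \<comment> \<open>The strict inequality \<open>?\<kappa> < 1\<close> gives the remainder kernel
    the positive mass \<open>1 - ?\<kappa>\<close>.\<close>
  then have "- (1 / exp 1) + - (1 / (2 * chi)) < 0"
    by linarith
  then show "?\<kappa> < 1"
    unfolding exp_add[symmetric] exp_less_one_iff .
  have "(\<lambda>(x, y). pmf (ideal_accept \<nu> U N q x y) True) \<in> borel_measurable (\<nu> \<Otimes>\<^sub>M \<nu>) \<longleftrightarrow>
      (\<lambda>(x, y). min 1 (mh_ratio x y)) \<in> borel_measurable (\<nu> \<Otimes>\<^sub>M \<nu>)"
    by (intro measurable_cong) (auto simp: space_pair_measure pmf_ideal_accept)
  then show "(\<lambda>(x, y). pmf (ideal_accept \<nu> U N q x y) True) \<in> borel_measurable (\<nu> \<Otimes>\<^sub>M \<nu>)"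
    using mh_ratio_measurable by simp
  show "(\<lambda>(x, y). pmf (tuna_accept U c M N chi q x y) True) \<in> borel_measurable (\<nu> \<Otimes>\<^sub>M \<nu>)"
    using accept_prob_measurable by (simp add: accept_prob_def)
qed (use q_measurable q_nonneg q_markov accept_prob_sym mh_ratio_sym accept_prob_compare
    in \<open>auto simp: accept_prob_def[symmetric] pmf_ideal_accept\<close>)

end

theorem proposition5:
  fixes \<nu> :: "'a measure"
    and U :: "nat \<Rightarrow> 'a \<Rightarrow> real"
    and N :: nat
    and c :: "nat \<Rightarrow> real"
    and M :: "'a \<Rightarrow> 'a \<Rightarrow> real"
    and q :: "'a \<Rightarrow> 'a \<Rightarrow> real"
    and chi :: real
  assumes U_measurable: "\<And>i. i \<in> {1..N} \<Longrightarrow> U i \<in> borel_measurable \<nu>"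
    and normalizable: "integrable \<nu> (\<lambda>\<theta>. exp (- (\<Sum>i=1..N. U i \<theta>)))"
      "(\<integral>\<theta>. exp (- (\<Sum>i=1..N. U i \<theta>)) \<partial>\<nu>) > 0"
    and c_pos: "\<And>i. i \<in> {1..N} \<Longrightarrow> c i > 0"
    and M_measurable: "(\<lambda>(\<theta>, \<theta>'). M \<theta> \<theta>') \<in> borel_measurable (\<nu> \<Otimes>\<^sub>M \<nu>)"
    and M_sym: "\<And>\<theta> \<theta>'. \<theta> \<in> space \<nu> \<Longrightarrow> \<theta>' \<in> space \<nu> \<Longrightarrow> M \<theta> \<theta>' = M \<theta>' \<theta>"
    and M_nonneg: "\<And>\<theta> \<theta>'. \<theta> \<in> space \<nu> \<Longrightarrow> \<theta>' \<in> space \<nu> \<Longrightarrow> M \<theta> \<theta>' \<ge> 0"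
    and U_bound: "\<And>i \<theta> \<theta>'. i \<in> {1..N} \<Longrightarrow> \<theta> \<in> space \<nu> \<Longrightarrow> \<theta>' \<in> space \<nu> \<Longrightarrow>
      \<bar>U i \<theta>' - U i \<theta>\<bar> \<le> c i * M \<theta> \<theta>'"
    and q_measurable: "(\<lambda>(\<theta>, \<theta>'). q \<theta> \<theta>') \<in> borel_measurable (\<nu> \<Otimes>\<^sub>M \<nu>)"
    and q_nonneg: "\<And>\<theta> \<theta>'. \<theta> \<in> space \<nu> \<Longrightarrow> \<theta>' \<in> space \<nu> \<Longrightarrow> q \<theta> \<theta>' \<ge> 0"
    and q_markov: "\<And>\<theta>. \<theta> \<in> space \<nu> \<Longrightarrow> (\<integral>\<^sup>+\<theta>'. ennreal (q \<theta> \<theta>') \<partial>\<nu>) = 1"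
    and chi_pos: "chi > 0"
  shows "Gap (target \<nu> U N) (P_aux \<nu> U c M N chi q)
    \<ge> ereal (exp (- (1 / exp 1)) * exp (- (1 / (2 * chi)))) * Gap (target \<nu> U N) (P_ideal \<nu> U N q)"
proof -
  interpret tuna_mh \<nu> U N c M q chi
    using assms by unfold_locales auto
  show ?thesis
    by (rule Gap_P_aux_ge)
qed

end
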